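(* Let $X$ be a non-empty compact metric space, let $I_{\mathrm{ineq}}, I_{\mathrm{eq}}$ be disjoint finite sets with $0\notin I:=I_{\mathrm{ineq}}\cup I_{\mathrm{eq}}$, let $\Psi_i:\Xi(X)\to\mathbb{R}\cup\{\infty\}$ be lower semicontinuous for $i\in\{0\}\cup I_{\mathrm{ineq}}$ and let $\Psi_i:\Xi(X)\to\mathbb{R}$ be continuous for $i\in I_{\mathrm{eq}}$. Assume moreover: (1) $\Psi_0$ is convex and $\Psi_0|_{\operatorname{dom}\Psi_0}$ is directionally differentiable w.r.t. $\Xi(X)$ with a continuous sensitivity function $\psi_0:\operatorname{dom}\Psi_0\times X\to\mathbb{R}$; (2) for every $i\in I_{\mathrm{ineq}}$, $\Psi_i$ is convex and $\Psi_i|_{\operatorname{dom}\Psi_i}$ is directionally differentiable w.r.t. $\Xi(X)$ with a sensitivity function $\psi_i:\operatorname{dom}\Psi_i\times X\to\mathbb{R}$ that is either continuous, or of the form $\psi_i(\xi,x)=g_i(x)-\Psi_i(\xi)$ for all $(\xi,x)\in\operatorname{dom}\Psi_i\times X$ with some bounded measurable $g_i:X\to\mathbb{R}$; (3) $\Psi_i$ is affine for every $i\in I_{\mathrm{eq}}$. Let $\varepsilon>0$ and let $\underline{\delta}_k\in(0,\infty)$ $(k\in\mathbb{N}_0)$ be tolerances with $\limsup_{k\to\infty}\underline{\delta}_k<\varepsilon$, and let $X^0\neq\emptyset$ be a finite subset of $X$ such that (i) there exists $\eta^0\in\Xi_{\mathrm{fin}}(X^0)$ with $\Psi_i(\eta^0)<0$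 for all $i\in I_{\mathrm{ineq}}$ and $\Psi_i(\eta^0)=0$ for all $i\in I_{\mathrm{eq}}$, and (ii) the set $\{(\Psi_i(\xi))_{i\in I_{\mathrm{eq}}}:\xi\in\Xi(X^0)\}\subset\mathbb{R}^{I_{\mathrm{eq}}}$ is not one-sided w.r.t. $0$. Let $(\xi^k),(\lambda^k),(x^k)$ be generated by the general adaptive discretization algorithm (see context) with initial discretization $X^0$ and tolerances $\underline{\delta}_k$ and $\varepsilon$. Then $(\xi^k)$ terminates (after finitely many iterations) at an $\varepsilon$-optimal solution of $\min_{\xi\in\Xi_{\mathrm{feas}}(X)}\Psi_0(\xi)$.
   Context: $\Xi(X)$ is the set of Borel probability measures on $X$ with the weak topology (convergence in distribution); (semi)continuity refers to this topology. For closed $\emptyset\ne X^*\subset X$, $\Xi(X^* )$ is regarded as a subset of $\Xi(X)$ (extension by zero). $\operatorname{dom}\Psi:=\{\xi\in\Xi(X):\Psi(\xi)<\infty\}$. $\Psi|_{\operatorname{dom}\Psi}$ is directionally differentiable w.r.t. $\Xi(X)$ iff there is a (necessarily unique) function $\psi:\operatorname{dom}\Psi\times X\to\mathbb{R}$, called its sensitivity function, such that for every $\xi\in\operatorname{dom}\Psi$ and $\eta\in\Xi(X)$ the function $\psi(\xi,\cdot)$ is $\eta$-integrable and $\frac{\Psi(\xi+\alpha(\eta-\xi))-\Psi(\xi)}{\alpha}\to\int_X\psi(\xi,x)\,\mathrm{d}\eta(x)$ as $\alpha\searrow0$. For $i\in I_{\mathrm{eq}}$ the sensitivity function of the affine continuous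 $\Psi_i$ is $\psi_i(\xi,x)=\Psi_i(\delta_x)-\Psi_i(\xi)$. For closed $\emptyset\neq X^*\subset X$: $\Xi_{\mathrm{feas}}(X^* ):=\{\xi\in\Xi(X^* ):\Psi_i(\xi)\le0\ (i\in I_{\mathrm{ineq}}),\ \Psi_i(\xi)=0\ (i\in I_{\mathrm{eq}})\}$ and $\Xi_{\mathrm{fin}}(X^* ):=\Xi(X^* )\cap\operatorname{dom}\Psi_0\cap\bigcap_{i\in I}\operatorname{dom}\Psi_i$. Further $\Lambda:=[0,\infty)^{I_{\mathrm{ineq}}}\times\mathbb{R}^{I_{\mathrm{eq}}}$, $L(\xi,\lambda):=\Psi_0(\xi)+\sum_{i\in I}\lambda_i\Psi_i(\xi)$ and $\psi^L(\xi,\lambda,x):=\psi_0(\xi,x)+\sum_{i\in I}\lambda_i\psi_i(\xi,x)$ for $\xi\in\Xi_{\mathrm{fin}}(X)$, $\lambda\in\Lambda$, $x\in X$. A saddle point of the problem $\min_{\xi\in\Xi_{\mathrm{feas}}(X^* )}\Psi_0(\xi)$ is a pair $(\xi^*,\lambda^* )\in\Xi_{\mathrm{fin}}(X^* )\times\Lambda$ with $L(\xi^*,\lambda)\le L(\xi^*,\lambda^* )\le L(\xi,\lambda^* )$ for all $\xi\in\Xi_{\mathrm{fin}}(X^* )$, $\lambda\in\Lambda$. An $\varepsilon$-optimal solution of $\min_{\xi\in\Xi_{\mathrm{feas}}(X)}\Psi_0(\xi)$ is a $\xi^*\in\Xi_{\mathrm{feas}}(X)$ with $\Psi_0(\xi^*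 )\le\inf_{\xi\in\Xi_{\mathrm{feas}}(X)}\Psi_0(\xi)+\varepsilon$. A subset $Z\subset\mathbb{R}^J$ ($J$ finite) is one-sided w.r.t. $0$ iff there is $\nu\in\mathbb{R}^J\setminus\{0\}$ with $\nu^\top z\ge0$ for all $z\in Z$ (so if $J=\emptyset$, no set is one-sided). General adaptive discretization algorithm. Input: non-empty finite $X^0\subset X$, tolerances $\underline{\delta}_k>0$ and $\varepsilon\ge0$. Start with $k=0$. Step 1: compute a saddle point $(\xi^k,\lambda^k)$ of $\min_{\xi\in\Xi_{\mathrm{feas}}(X^k)}\Psi_0(\xi)$. Step 2: using an arbitrary finite search routine, search for a point of $V^k:=\{x\in X:\psi^L(\xi^k,\lambda^k,x)<-\varepsilon\}$. If the routine finds a point $x^k\in V^k$, set $X^{k+1}:=X^k\cup\{x^k\}$ and return to Step 1 with $k+1$ in place of $k$. If the routine finds no point (which may happen even if $V^k\neq\emptyset$), compute $x^k\in X$ with $\psi^L(\xi^k,\lambda^k,x^k)\le\inf_{x\in X}\psi^L(\xi^k,\lambda^k,x)+\underline{\delta}_k$; if $\psi^L(\xi^k,\lambda^k,x^k)-\underline{\delta}_k<-\varepsilon$, set $X^{k+1}:=X^k\cup\{x^k\}$ and return to Step 1 with $k+1$ in place of $k$; otherwise terminate (at $\xi^k$). All choices (saddle points, search results, approximate minimizers) are arbitrary. *)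

theory Defs
  imports "HOL-Probability.Probability"
begin

section \<open>Borel probability measures with the weak topology\<close>

text \<open>
  The compact space is the whole type (compactness of \<^term>\<open>UNIV\<close> is a hypothesis of the
  theorem). \<open>Xi S\<close> consists of the Borel probability measures on the whole space that are
  concentrated on \<open>S\<close>; the lemma \<open>Xi_eq_extension\<close> below shows that these are exactly the
  extensions by zero of the Borel probability measures on the subspace \<open>S\<close>.
\<close>

definition Xi :: "'a::topological_space set \<Rightarrow> 'a measure set" where
  "Xi S = {\<xi>. sets \<xi> = sets borel \<and> prob_space \<xi> \<and> emeasure \<xi> (- S) = 0}"

lemma Xi_UNIV: "Xi UNIV = {\<xi>. sets \<xi> = sets borel \<and> prob_space \<xi>}"
  by (auto simp: Xi_def)

lemma Xi_mono: "S \<subseteq> T \<Longrightarrow> S \<in> sets borel \<Longrightarrow> Xi S \<subseteq> Xi T"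
  unfolding Xi_def by (auto intro!: emeasure_eq_0[where N = "- S"])

lemma Xi_eq_extension:
  fixes S :: "'a::topological_space set"
  assumes S: "closed S"
  shows "Xi S = {distr \<mu> borel (\<lambda>x. x) | \<mu>. prob_space \<mu> \<and> sets \<mu> = sets (restrict_space borel S)}"
    (is "_ = ?R")
proof (intro set_eqI iffI)
  have Sm: "S \<in> sets borel" using S by simp
  have id_m: "(\<lambda>x. x) \<in> measurable (restrict_space borel S) borel"
    by (simp add: measurable_restrict_space1)
  {
    fix \<xi> assume "\<xi> \<in> ?R"
    then obtain \<mu> where \<mu>: "prob_space \<mu>" "sets \<mu> = sets (restrict_space borel S)"
      and eq: "\<xi> = distr \<mu> borel (\<lambda>x. x)" by auto
    have m: "(\<lambda>x. x) \<in> measurable \<mu> borel"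
      using id_m measurable_cong_sets[OF \<mu>(2) refl] by blast
    have sp: "space \<mu> = S"
      using sets_eq_imp_space_eq[OF \<mu>(2)] by (simp add: space_restrict_space)
    have "emeasure \<xi> (- S) = emeasure \<mu> ((- S) \<inter> space \<mu>)"
      unfolding eq using Sm by (subst emeasure_distr[OF m]) auto
    then have "emeasure \<xi> (- S) = 0" by (simp add: sp)
    then show "\<xi> \<in> Xi S"
      unfolding Xi_def using prob_space.prob_space_distr[OF \<mu>(1) m] eq by simp
  }
  {
    fix \<xi> assume "\<xi> \<in> Xi S"
    then have s: "sets \<xi> = sets borel" and p: "prob_space \<xi>" and z: "emeasure \<xi> (- S) = 0"
      by (auto simp: Xi_def)
    interpret prob_space \<xi> by (rule p)
    have sp: "space \<xi> = UNIV" using sets_eq_imp_space_eq[OF s] by simp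
    have SM: "S \<inter> space \<xi> \<in> sets \<xi>" using Sm s sp by simp
    have full: "emeasure \<xi> (A \<inter> S) = emeasure \<xi> A" if A: "A \<in> sets borel" for A
    proof -
      have "A = (A \<inter> S) \<union> (A \<inter> - S)" by auto
      moreover have "emeasure \<xi> (A \<inter> - S) = 0"
        by (rule emeasure_eq_0[OF _ z]) (use Sm s in auto)
      ultimately show ?thesis
        using emeasure_Un_null_set[of "A \<inter> S" \<xi> "A \<inter> - S"] A Sm s by (auto simp: null_sets_def)
    qed
    let ?m = "restrict_space \<xi> S"
    have "emeasure ?m (space ?m) = 1"
      using full[of UNIV] emeasure_space_1 sp
      by (simp add: emeasure_restrict_space[OF SM] space_restrict_space)
    then have P: "prob_space ?m" by (rule prob_spaceI)
    have SS: "sets ?m = sets (restrict_space borel S)"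
      by (rule sets_restrict_space_cong[OF s])
    have m: "(\<lambda>x. x) \<in> measurable ?m borel"
      using id_m measurable_cong_sets[OF SS refl] by blast
    have "\<xi> = distr ?m borel (\<lambda>x. x)"
    proof (rule measure_eqI)
      fix A assume "A \<in> sets \<xi>"
      then have A: "A \<in> sets borel" using s by simp
      have "emeasure (distr ?m borel (\<lambda>x. x)) A = emeasure ?m (A \<inter> S)"
        using A by (subst emeasure_distr[OF m]) (auto simp: space_restrict_space sp)
      also have "\<dots> = emeasure \<xi> A"
        using full[OF A] by (simp add: emeasure_restrict_space[OF SM])
      finally show "emeasure \<xi> A = emeasure (distr ?m borel (\<lambda>x. x)) A" by simp
    qed (simp add: s)
    then show "\<xi> \<in> ?R" using P SS by auto
  }
qed

text \<open>
  The coarsest topology on \<^term>\<open>Xi UNIV\<close> for which all integrals of bounded continuous functions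
  are continuous.
\<close>

definition weak_topology :: "'a::topological_space measure topology" where
  "weak_topology = topology_generated_by
     {{\<xi> \<in> Xi UNIV. (\<integral>x. f x \<partial>\<xi>) \<in> U} | f U.
        continuous_on UNIV f \<and> bounded (range f) \<and> open (U :: real set)}"

lemma topspace_weak_topology [simp]: "topspace weak_topology = Xi UNIV"
proof -
  have "Xi UNIV \<in> {{\<xi> \<in> Xi UNIV. (\<integral>x. f x \<partial>\<xi>) \<in> U} | f U.
        continuous_on UNIV f \<and> bounded (range f) \<and> open (U :: real set)}"
    by (intro CollectI exI[of _ "\<lambda>_. 0"] exI[of _ UNIV]) auto
  then show ?thesis unfolding weak_topology_def by auto
qed

lemma continuous_map_weak_integral:
  fixes f :: "'a::topological_space \<Rightarrow> real"
  assumes "continuous_on UNIV f" "bounded (range f)"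
  shows "continuous_map weak_topology euclideanreal (\<lambda>\<xi>. \<integral>x. f x \<partial>\<xi>)"
  unfolding continuous_map_def
proof (intro conjI allI impI)
  fix U :: "real set" assume "openin euclideanreal U"
  then show "openin weak_topology {\<xi> \<in> topspace weak_topology. (\<integral>x. f x \<partial>\<xi>) \<in> U}"
    using assms unfolding topspace_weak_topology unfolding weak_topology_def
    by (intro topology_generated_by_Basis) auto
qed auto

text \<open>
  \<open>mix \<xi> \<eta> \<alpha>\<close> is \<open>\<xi> + \<alpha> (\<eta> - \<xi>)\<close>; it is only used for \<open>0 \<le> \<alpha> \<le> 1\<close>.
\<close>

definition mix :: "'a::topological_space measure \<Rightarrow> 'a measure \<Rightarrow> real \<Rightarrow> 'a measure" where
  "mix \<xi> \<eta> \<alpha> = measure_of UNIV (sets borel)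
     (\<lambda>A. ennreal (1 - \<alpha>) * emeasure \<xi> A + ennreal \<alpha> * emeasure \<eta> A)"

lemma space_mix [simp]: "space (mix \<xi> \<eta> \<alpha>) = UNIV"
  unfolding mix_def by (simp add: space_measure_of_conv)

lemma sets_mix [simp]: "sets (mix \<xi> \<eta> \<alpha>) = sets borel"
  unfolding mix_def by (metis sets.sets_measure_of_eq space_borel)

lemma emeasure_mix:
  assumes "sets \<xi> = sets borel" "sets \<eta> = sets borel" "A \<in> sets borel"
  shows "emeasure (mix \<xi> \<eta> \<alpha>) A = ennreal (1 - \<alpha>) * emeasure \<xi> A + ennreal \<alpha> * emeasure \<eta> A"
proof (rule emeasure_measure_of[OF mix_def])
  show "A \<in> sets (mix \<xi> \<eta> \<alpha>)" using assms by simp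
  show "countably_additive (sets (mix \<xi> \<eta> \<alpha>))
    (\<lambda>A. ennreal (1 - \<alpha>) * emeasure \<xi> A + ennreal \<alpha> * emeasure \<eta> A)"
  proof (rule countably_additiveI)
    fix F :: "nat \<Rightarrow> 'a set"
    assume F: "range F \<subseteq> sets (mix \<xi> \<eta> \<alpha>)" "disjoint_family F"
    then show "(\<Sum>i. ennreal (1 - \<alpha>) * emeasure \<xi> (F i) + ennreal \<alpha> * emeasure \<eta> (F i)) =
      ennreal (1 - \<alpha>) * emeasure \<xi> (\<Union> (range F)) + ennreal \<alpha> * emeasure \<eta> (\<Union> (range F))"
      using assms suminf_emeasure[of F \<xi>] suminf_emeasure[of F \<eta>]
      by (simp add: suminf_add[symmetric])
  qed
qed (auto simp: positive_def)

lemma mix_in_Xi: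
  assumes \<xi>: "\<xi> \<in> Xi S" and \<eta>: "\<eta> \<in> Xi S" and S: "S \<in> sets borel" and \<alpha>: "0 \<le> \<alpha>" "\<alpha> \<le> 1"
  shows "mix \<xi> \<eta> \<alpha> \<in> Xi S"
proof -
  have s: "sets \<xi> = sets borel" "sets \<eta> = sets borel" using \<xi> \<eta> by (auto simp: Xi_def)
  have "space \<xi> = UNIV" "space \<eta> = UNIV"
    using s by (auto dest: sets_eq_imp_space_eq)
  moreover have "emeasure \<xi> (space \<xi>) = 1" "emeasure \<eta> (space \<eta>) = 1"
    using \<xi> \<eta> by (auto simp: Xi_def prob_space.emeasure_space_1)
  ultimately have "prob_space (mix \<xi> \<eta> \<alpha>)"
    using \<alpha> by (intro prob_spaceI) (simp add: emeasure_mix[OF s] ennreal_plus[symmetric] del: ennreal_plus)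
  moreover have "emeasure (mix \<xi> \<eta> \<alpha>) (- S) = 0"
    using \<xi> \<eta> S by (simp add: emeasure_mix[OF s] Xi_def)
  ultimately show ?thesis by (simp add: Xi_def)
qed


section \<open>Extended real-valued functions of measures\<close>

text \<open>
  Functions into \<open>\<real> \<union> {\<infinity>}\<close> are \<^typ>\<open>ereal\<close>-valued functions omitting \<open>-\<infinity>\<close> on \<^term>\<open>Xi UNIV\<close>; their
  values outside \<^term>\<open>Xi UNIV\<close> never matter.
\<close>

definition proper_on_Xi :: "('a::topological_space measure \<Rightarrow> ereal) \<Rightarrow> bool" where
  "proper_on_Xi \<Psi> \<longleftrightarrow> (\<forall>\<xi> \<in> Xi UNIV. \<Psi> \<xi> \<noteq> - \<infinity>)"

definition real_valued_on_Xi :: "('a::topological_space measure \<Rightarrow> ereal) \<Rightarrow> bool" where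
  "real_valued_on_Xi \<Psi> \<longleftrightarrow> (\<forall>\<xi> \<in> Xi UNIV. \<bar>\<Psi> \<xi>\<bar> \<noteq> \<infinity>)"

definition dom :: "('a::topological_space measure \<Rightarrow> ereal) \<Rightarrow> 'a measure set" where
  "dom \<Psi> = {\<xi> \<in> Xi UNIV. \<Psi> \<xi> < \<infinity>}"

definition lower_semicontinuous :: "('a::topological_space measure \<Rightarrow> ereal) \<Rightarrow> bool" where
  "lower_semicontinuous \<Psi> \<longleftrightarrow> (\<forall>c. openin weak_topology {\<xi> \<in> Xi UNIV. c < \<Psi> \<xi>})"

definition convex_on_Xi :: "('a::topological_space measure \<Rightarrow> ereal) \<Rightarrow> bool" where
  "convex_on_Xi \<Psi> \<longleftrightarrow> (\<forall>\<xi> \<in> Xi UNIV. \<forall>\<eta> \<in> Xi UNIV. \<forall>\<alpha> \<in> {0..1}.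
     \<Psi> (mix \<xi> \<eta> \<alpha>) \<le> ereal (1 - \<alpha>) * \<Psi> \<xi> + ereal \<alpha> * \<Psi> \<eta>)"

definition affine_on_Xi :: "('a::topological_space measure \<Rightarrow> ereal) \<Rightarrow> bool" where
  "affine_on_Xi \<Psi> \<longleftrightarrow> (\<forall>\<xi> \<in> Xi UNIV. \<forall>\<eta> \<in> Xi UNIV. \<forall>\<alpha> \<in> {0..1}.
     \<Psi> (mix \<xi> \<eta> \<alpha>) = ereal (1 - \<alpha>) * \<Psi> \<xi> + ereal \<alpha> * \<Psi> \<eta>)"

text \<open>
  The difference quotient is taken in \<^typ>\<open>ereal\<close>, since \<open>mix \<xi> \<eta> \<alpha>\<close> need not be in the domain for
  large \<open>\<alpha>\<close>; convergence to a real limit forces it to be there for all small \<open>\<alpha> > 0\<close>.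
  Only the values of \<open>\<psi> \<xi>\<close> for \<open>\<xi> \<in> dom \<Psi>\<close> matter.
\<close>

definition sensitivity_function ::
    "('a::topological_space measure \<Rightarrow> ereal) \<Rightarrow> ('a measure \<Rightarrow> 'a \<Rightarrow> real) \<Rightarrow> bool" where
  "sensitivity_function \<Psi> \<psi> \<longleftrightarrow> (\<forall>\<xi> \<in> dom \<Psi>. \<forall>\<eta> \<in> Xi UNIV.
     integrable \<eta> (\<psi> \<xi>) \<and>
     ((\<lambda>\<alpha>. (\<Psi> (mix \<xi> \<eta> \<alpha>) - \<Psi> \<xi>) / ereal \<alpha>) \<longlongrightarrow> ereal (\<integral>x. \<psi> \<xi> x \<partial>\<eta>)) (at_right 0))"

definition continuous_sensitivity ::
    "('a::topological_space measure \<Rightarrow> ereal) \<Rightarrow> ('a measure \<Rightarrow> 'a \<Rightarrow> real) \<Rightarrow> bool" where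
  "continuous_sensitivity \<Psi> \<psi> \<longleftrightarrow>
     continuous_map (prod_topology (subtopology weak_topology (dom \<Psi>)) euclidean) euclideanreal
       (\<lambda>(\<xi>, x). \<psi> \<xi> x)"

definition integral_type_sensitivity ::
    "('a::topological_space measure \<Rightarrow> ereal) \<Rightarrow> ('a measure \<Rightarrow> 'a \<Rightarrow> real) \<Rightarrow> bool" where
  "integral_type_sensitivity \<Psi> \<psi> \<longleftrightarrow>
     (\<exists>g. g \<in> borel_measurable borel \<and> bounded (range g) \<and>
          (\<forall>\<xi> \<in> dom \<Psi>. \<forall>x. \<psi> \<xi> x = g x - real_of_ereal (\<Psi> \<xi>)))"


section \<open>The constrained problem and its saddle points\<close>

text \<open>
  The objective is \<open>\<Psi> 0\<close>. Vectors in \<open>\<real>\<^sup>J\<close> for a finite index set \<open>J\<close> are represented by functions on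
  the whole index type whose values outside \<open>J\<close> are ignored.
\<close>

definition Xi_feas ::
    "('i \<Rightarrow> 'a::topological_space measure \<Rightarrow> ereal) \<Rightarrow> 'i set \<Rightarrow> 'i set \<Rightarrow> 'a set \<Rightarrow> 'a measure set" where
  "Xi_feas \<Psi> Iineq Ieq S = {\<xi> \<in> Xi S. (\<forall>i \<in> Iineq. \<Psi> i \<xi> \<le> 0) \<and> (\<forall>i \<in> Ieq. \<Psi> i \<xi> = 0)}"

definition Xi_fin ::
    "('i::zero \<Rightarrow> 'a::topological_space measure \<Rightarrow> ereal) \<Rightarrow> 'i set \<Rightarrow> 'i set \<Rightarrow> 'a set \<Rightarrow> 'a measure set" where
  "Xi_fin \<Psi> Iineq Ieq S = Xi S \<inter> dom (\<Psi> 0) \<inter> (\<Inter>i \<in> Iineq \<union> Ieq. dom (\<Psi> i))"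

definition multipliers :: "'i set \<Rightarrow> ('i \<Rightarrow> real) set" where
  "multipliers Iineq = {l. \<forall>i \<in> Iineq. 0 \<le> l i}"

definition Lagrangian ::
    "('i::zero \<Rightarrow> 'a::topological_space measure \<Rightarrow> ereal) \<Rightarrow> 'i set \<Rightarrow> 'i set \<Rightarrow>
     'a measure \<Rightarrow> ('i \<Rightarrow> real) \<Rightarrow> real" where
  "Lagrangian \<Psi> Iineq Ieq \<xi> mu =
     real_of_ereal (\<Psi> 0 \<xi>) + (\<Sum>i \<in> Iineq \<union> Ieq. mu i * real_of_ereal (\<Psi> i \<xi>))"

definition psiL ::
    "('i::zero \<Rightarrow> 'a measure \<Rightarrow> 'a \<Rightarrow> real) \<Rightarrow> 'i set \<Rightarrow> 'i set \<Rightarrow>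
     'a measure \<Rightarrow> ('i \<Rightarrow> real) \<Rightarrow> 'a \<Rightarrow> real" where
  "psiL \<psi> Iineq Ieq \<xi> mu x = \<psi> 0 \<xi> x + (\<Sum>i \<in> Iineq \<union> Ieq. mu i * \<psi> i \<xi> x)"

definition saddle_point ::
    "('i::zero \<Rightarrow> 'a::topological_space measure \<Rightarrow> ereal) \<Rightarrow> 'i set \<Rightarrow> 'i set \<Rightarrow> 'a set \<Rightarrow>
     'a measure \<Rightarrow> ('i \<Rightarrow> real) \<Rightarrow> bool" where
  "saddle_point \<Psi> Iineq Ieq S \<xi>' mu' \<longleftrightarrow>
     \<xi>' \<in> Xi_fin \<Psi> Iineq Ieq S \<and> mu' \<in> multipliers Iineq \<and>
     (\<forall>\<xi> \<in> Xi_fin \<Psi> Iineq Ieq S. \<forall>mu \<in> multipliers Iineq.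
        Lagrangian \<Psi> Iineq Ieq \<xi>' mu \<le> Lagrangian \<Psi> Iineq Ieq \<xi>' mu' \<and>
        Lagrangian \<Psi> Iineq Ieq \<xi>' mu' \<le> Lagrangian \<Psi> Iineq Ieq \<xi> mu')"

definition eps_optimal ::
    "('i::zero \<Rightarrow> 'a::topological_space measure \<Rightarrow> ereal) \<Rightarrow> 'i set \<Rightarrow> 'i set \<Rightarrow> real \<Rightarrow>
     'a measure \<Rightarrow> bool" where
  "eps_optimal \<Psi> Iineq Ieq \<epsilon> \<xi>' \<longleftrightarrow>
     \<xi>' \<in> Xi_feas \<Psi> Iineq Ieq UNIV \<and>
     \<Psi> 0 \<xi>' \<le> (INF \<xi> \<in> Xi_feas \<Psi> Iineq Ieq UNIV. \<Psi> 0 \<xi>) + ereal \<epsilon>"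

definition one_sided :: "'i set \<Rightarrow> ('i \<Rightarrow> real) set \<Rightarrow> bool" where
  "one_sided J Z \<longleftrightarrow> (\<exists>\<nu>. (\<exists>j \<in> J. \<nu> j \<noteq> 0) \<and> (\<forall>z \<in> Z. 0 \<le> (\<Sum>j \<in> J. \<nu> j * z j)))"


section \<open>The adaptive discretization algorithm\<close>

definition violation_set :: "('a \<Rightarrow> real) \<Rightarrow> real \<Rightarrow> 'a set" where
  "violation_set p \<epsilon> = {x. p x < - \<epsilon>}"

definition approx_minimizer :: "('a \<Rightarrow> real) \<Rightarrow> real \<Rightarrow> 'a \<Rightarrow> bool" where
  "approx_minimizer p \<delta> x \<longleftrightarrow> ereal (p x) \<le> (INF y. ereal (p y)) + ereal \<delta>"

text \<open>
  Here \<open>p\<close> is \<open>\<psi>\<^sup>L(\<xi>\<^sup>k, \<lambda>\<^sup>k, \<cdot>)\<close>. The search routine is arbitrary: it may return any point of the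
  violation set (first disjunct of \<open>continue_step\<close>), and it may always fail, in which case an
  approximate minimizer is computed and the stopping test decides whether to continue (second
  disjunct) or to stop (\<open>terminate_step\<close>).
\<close>

definition continue_step :: "('a \<Rightarrow> real) \<Rightarrow> real \<Rightarrow> real \<Rightarrow> 'a \<Rightarrow> bool" where
  "continue_step p \<epsilon> \<delta> x \<longleftrightarrow>
     x \<in> violation_set p \<epsilon> \<or> (approx_minimizer p \<delta> x \<and> p x - \<delta> < - \<epsilon>)"

definition terminate_step :: "('a \<Rightarrow> real) \<Rightarrow> real \<Rightarrow> real \<Rightarrow> 'a \<Rightarrow> bool" where
  "terminate_step p \<epsilon> \<delta> x \<longleftrightarrow> approx_minimizer p \<delta> x \<and> \<not> (p x - \<delta> < - \<epsilon>)"

text \<open>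
  \<open>K\<close> is the index of the last iteration; \<open>K = \<infinity>\<close> is the case of a run that never terminates.
  Entries of the sequences beyond \<open>K\<close> are unconstrained.
\<close>

definition generated_by_algorithm ::
    "('i::zero \<Rightarrow> 'a::topological_space measure \<Rightarrow> ereal) \<Rightarrow> ('i \<Rightarrow> 'a measure \<Rightarrow> 'a \<Rightarrow> real) \<Rightarrow>
     'i set \<Rightarrow> 'i set \<Rightarrow> 'a set \<Rightarrow> (nat \<Rightarrow> real) \<Rightarrow> real \<Rightarrow>
     (nat \<Rightarrow> 'a set) \<Rightarrow> (nat \<Rightarrow> 'a measure) \<Rightarrow> (nat \<Rightarrow> 'i \<Rightarrow> real) \<Rightarrow> (nat \<Rightarrow> 'a) \<Rightarrow> enat \<Rightarrow> bool" where
  "generated_by_algorithm \<Psi> \<psi> Iineq Ieq X0 \<delta> \<epsilon> Xs \<xi> mu x K \<longleftrightarrow>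
     Xs 0 = X0 \<and>
     (\<forall>k. enat k \<le> K \<longrightarrow> saddle_point \<Psi> Iineq Ieq (Xs k) (\<xi> k) (mu k)) \<and>
     (\<forall>k. enat k < K \<longrightarrow>
        continue_step (psiL \<psi> Iineq Ieq (\<xi> k) (mu k)) \<epsilon> (\<delta> k) (x k) \<and>
        Xs (Suc k) = insert (x k) (Xs k)) \<and>
     (\<forall>k. enat k = K \<longrightarrow> terminate_step (psiL \<psi> Iineq Ieq (\<xi> k) (mu k)) \<epsilon> (\<delta> k) (x k))"

end

theory Submission
  imports Defs
begin

text \<open>
  On termination, \<open>\<psi>\<^sup>L \<ge> - \<epsilon>\<close> on all of \<open>X\<close>, and convexity gives
  \<open>\<Psi>\<^sub>0(\<eta>) - \<Psi>\<^sub>0(\<xi>) \<ge> \<integral> \<psi>\<^sup>L d\<eta> \<ge> - \<epsilon>\<close> for every feasible \<open>\<eta>\<close>; here the equality constraints enter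
  through \<open>\<Psi>\<^sub>i(\<eta>) = \<integral> \<Psi>\<^sub>i(\<delta>\<^sub>x) d\<eta>(x)\<close>, which holds because finitely supported measures are
  weakly dense.

  In an infinite run, the multipliers are bounded: a limit of normalized multipliers would
  vanish on the inequalities by the Slater condition and then contradict that the image of the
  equality constraints is not one-sided. Pass to a subsequence \<open>r\<close> along which \<open>\<xi>\<^sup>k\<close>, \<open>\<lambda>\<^sup>k\<close>, \<open>x\<^sup>k\<close>
  and the real numbers \<open>\<Psi>\<^sub>i(\<xi>\<^sup>k)\<close>, \<open>g\<^sub>i(x\<^sup>k)\<close> converge. The point found in
  iteration \<open>r(n)\<close> belongs to the discretization of iteration \<open>r(n+1)\<close>, where the saddle point
  property forces \<open>\<psi>\<^sup>L \<ge> 0\<close> at it, whereas in iteration \<open>r(n)\<close> the value of \<open>\<psi>\<^sup>L\<close> there is at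
  most a negative constant. Both values have the same limit, a contradiction.
\<close>

section \<open>Sequential compactness of the set of probability measures\<close>

text \<open>Eventual membership passes to finite intersections, and to a union as soon as one member
  contains the limit. So only the generating sets have to be tested; the induction follows the
  generation of open sets.\<close>

lemma limitin_weak_topologyI:
  assumes \<xi>: "\<xi> \<in> Xi UNIV" and \<mu>: "eventually (\<lambda>n. \<mu> n \<in> Xi UNIV) F"
    and lim: "\<And>f :: 'a::topological_space \<Rightarrow> real. continuous_on UNIV f \<Longrightarrow> bounded (range f) \<Longrightarrow>
      ((\<lambda>n. \<integral>x. f x \<partial>\<mu> n) \<longlongrightarrow> (\<integral>x. f x \<partial>\<xi>)) F"
  shows "limitin weak_topology \<mu> \<xi> F"
  unfolding limitin_def
proof (intro conjI allI impI)
  show "\<xi> \<in> topspace weak_topology" using \<xi> by simp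
  fix U assume "openin weak_topology U \<and> \<xi> \<in> U"
  then have "generate_topology_on {{\<xi> \<in> Xi UNIV. (\<integral>x. f x \<partial>\<xi>) \<in> U} | f U.
        continuous_on UNIV (f :: 'a \<Rightarrow> real) \<and> bounded (range f) \<and> open (U :: real set)} U" "\<xi> \<in> U"
    unfolding weak_topology_def by (auto intro: openin_topology_generated_by)
  then show "eventually (\<lambda>n. \<mu> n \<in> U) F"
  proof (induction)
    case Empty
    then show ?case by simp
  next
    case (Int a b)
    then show ?case by (auto intro: eventually_conj)
  next
    case (UN K)
    then obtain k where "k \<in> K" "eventually (\<lambda>n. \<mu> n \<in> k) F" by auto
    then show ?case by (auto elim!: eventually_mono)
  next
    case (Basis s)
    then obtain f :: "'a \<Rightarrow> real" and V where s: "s = {\<xi> \<in> Xi UNIV. (\<integral>x. f x \<partial>\<xi>) \<in> V}"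
      and f: "continuous_on UNIV f" "bounded (range f)" "open V" by auto
    have "eventually (\<lambda>n. (\<integral>x. f x \<partial>\<mu> n) \<in> V) F"
      using topological_tendstoD[OF lim[OF f(1,2)] f(3)] Basis(2) s by auto
    with \<mu> show ?case by eventually_elim (simp add: s)
  qed
qed

section \<open>Coding a compact metric space by real numbers\<close>

text \<open>At the first index \<open>j\<close> where the digits differ they contribute
  \<open>(1/3)^j\<close>, and all later digits together at most half of that, so the sums differ by
  at least \<open>(1/3)^j / 2\<close>. Base 3 with digits 0 and 1 creates this gap; in base 2 the
  tail could cancel the difference.\<close>

lemma ternary_digits_eq:
  fixes a b :: "nat \<Rightarrow> real"
  assumes a: "\<And>j. a j \<in> {0, 1}" and b: "\<And>j. b j \<in> {0, 1}"
    and close: "\<bar>(\<Sum>j. a j * (1/3) ^ j) - (\<Sum>j. b j * (1/3) ^ j)\<bar> < (1/3) ^ J / 2"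
    and "i \<le> J"
  shows "a i = b i"
proof (rule ccontr)
  assume "a i \<noteq> b i"
  define j where "j = (LEAST j. a j \<noteq> b j)"
  have neq: "a j \<noteq> b j" and ji: "j \<le> i"
    unfolding j_def using LeastI[of "\<lambda>j. a j \<noteq> b j", OF \<open>a i \<noteq> b i\<close>]
      Least_le[of "\<lambda>j. a j \<noteq> b j", OF \<open>a i \<noteq> b i\<close>] by blast+
  have eq: "a l = b l" if "l < j" for l
    using not_less_Least that unfolding j_def by blast
  define c where "c l = (a l - b l) * (1/3) ^ l" for l
  have g: "summable (\<lambda>l. (1/3::real) ^ l)" by (rule summable_geometric) simp
  have "\<bar>a l\<bar> \<le> 1" "\<bar>b l\<bar> \<le> 1" "\<bar>a l - b l\<bar> \<le> 1" for l
    using a[of l] b[of l] by auto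
  then have sa: "summable (\<lambda>l. a l * (1/3) ^ l)" and sb: "summable (\<lambda>l. b l * (1/3) ^ l)"
    and c_le: "\<And>l. \<bar>c l\<bar> \<le> (1/3) ^ l"
    by (auto intro!: summable_comparison_test'[OF g, of 0] mult_left_le_one_le simp: abs_mult c_def)
  have sc: "summable c"
    by (rule summable_comparison_test'[OF g, of 0]) (use c_le in auto)
  have "(\<Sum>l. c l) = (\<Sum>l. c (l + Suc j)) + (\<Sum>l<Suc j. c l)"
    by (rule suminf_split_initial_segment[OF sc])
  also have "(\<Sum>l<Suc j. c l) = c j"
    using eq by (simp add: c_def)
  finally have split: "(\<Sum>l. c l) = (\<Sum>l. c (l + Suc j)) + c j" .
  have gs: "(\<lambda>l. (1/3::real) ^ (l + Suc j)) sums ((1/3) ^ Suc j * (3/2))"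
    using sums_mult[OF geometric_sums[of "1/3::real"], of "(1/3) ^ Suc j"]
    by (simp add: power_add mult_ac)
  have "\<bar>\<Sum>l. c (l + Suc j)\<bar> \<le> (\<Sum>l. (1/3::real) ^ (l + Suc j))"
    using norm_suminf_le[OF _ sums_summable[OF gs], of "\<lambda>l. c (l + Suc j)"] c_le
    unfolding real_norm_def by blast
  also have "\<dots> = (1/3) ^ j / 2" using sums_unique[OF gs] by simp
  finally have tail: "\<bar>\<Sum>l. c (l + Suc j)\<bar> \<le> (1/3) ^ j / 2" .
  have "\<bar>c j\<bar> = (1/3) ^ j" using neq a[of j] b[of j] by (auto simp: c_def)
  with tail split have "(1/3) ^ j / 2 \<le> \<bar>\<Sum>l. c l\<bar>" by linarith
  moreover have "(\<Sum>l. c l) = (\<Sum>j. a j * (1/3) ^ j) - (\<Sum>j. b j * (1/3) ^ j)"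
    using suminf_diff[OF sa sb] by (simp add: c_def algebra_simps)
  moreover have "(1/3::real) ^ J \<le> (1/3) ^ j"
    using ji \<open>i \<le> J\<close> by (intro power_decreasing) auto
  ultimately show False using close by linarith
qed

text \<open>
  Digits record membership in countably many small balls, so that \<open>h\<close> is Borel measurable with
  uniformly continuous inverse; this reduces weak compactness on \<open>X\<close> to Helly's theorem on the line.
\<close>

lemma compact_metric_encoding:
  assumes comp: "compact (UNIV :: 'a::metric_space set)"
  obtains h :: "'a::metric_space \<Rightarrow> real" where "h \<in> borel_measurable borel" "\<And>x. h x \<in> {0..2}"
    "\<And>e. e > 0 \<Longrightarrow> \<exists>d>0. \<forall>x y. \<bar>h x - h y\<bar> < d \<longrightarrow> dist x y < e"
proof -
  have "\<exists>F. finite F \<and> (UNIV :: 'a set) \<subseteq> (\<Union>c\<in>F. ball c (1 / Suc n))" for n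
    using compact_eq_totally_bounded[of "UNIV :: 'a set"] comp
    by (metis divide_pos_pos of_nat_0_less_iff zero_less_Suc zero_less_one)
  then obtain F where F: "\<And>n. finite (F n)" "\<And>n. (UNIV :: 'a set) \<subseteq> (\<Union>c\<in>F n. ball c (1 / Suc n))"
    by metis
  define B where "B = (\<Union>n. (\<lambda>c. ball c (1 / Suc n)) ` F n)"
  have B: "countable B" unfolding B_def using F by (auto intro: countable_finite)
  have "F 0 \<noteq> {}" using F(2)[of 0] by auto
  then have "B \<noteq> {}" unfolding B_def by auto
  \<comment> \<open>One sequence containing the balls of all nets, possibly with
    repetitions.\<close>
  define A where "A = from_nat_into B"
  have A: "range A = B" unfolding A_def by (rule range_from_nat_into[OF \<open>B \<noteq> {}\<close> B])
  have openA: "open (A j)" for j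
  proof -
    have "A j \<in> B" using A by auto
    then show ?thesis unfolding B_def by auto
  qed
  define h where "h x = (\<Sum>j. indicator (A j) x * (1/3::real) ^ j)" for x
  have g: "summable (\<lambda>l. (1/3::real) ^ l)" by (rule summable_geometric) simp
  have s: "summable (\<lambda>j. indicator (A j) x * (1/3::real) ^ j)" for x
    by (rule summable_comparison_test'[OF g, of 0]) (auto split: split_indicator)
  show thesis
  proof
    show "h \<in> borel_measurable borel"
      unfolding h_def using openA by (intro borel_measurable_suminf) (auto intro!: borel_measurable_times)
    fix x
    have "h x \<le> (\<Sum>l. (1/3::real) ^ l)"
      unfolding h_def by (intro suminf_le s g) (auto split: split_indicator)
    also have "\<dots> \<le> 2" by (subst suminf_geometric) auto
    finally show "h x \<in> {0..2}" using suminf_nonneg[OF s[of x]] by (auto simp: h_def)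
  next
    fix e :: real assume "e > 0"
    then obtain n where "inverse (Suc n) < e / 2" using reals_Archimedean[of "e/2"] by auto
    then have n: "1 / Suc n < e / 2" by (simp add: field_simps)
    have "\<forall>c\<in>F n. \<exists>j. ball c (1 / Suc n) = A j"
      using A unfolding B_def by blast
    then obtain idx where idx: "\<And>c. c \<in> F n \<Longrightarrow> ball c (1 / Suc n) = A (idx c)" by metis
    \<comment> \<open>Codes closer than \<open>(1/3)^J / 2\<close> agree in every digit that records
      membership in a ball of the \<open>n\<close>-th net.\<close>
    define J where "J = Max (idx ` F n)"
    have J: "idx c \<le> J" if "c \<in> F n" for c
      unfolding J_def using F(1) that by auto
    show "\<exists>d>0. \<forall>x y. \<bar>h x - h y\<bar> < d \<longrightarrow> dist x y < e"
    proof (intro exI[of _ "(1/3)^J / 2"] conjI allI impI)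
      fix x y assume d: "\<bar>h x - h y\<bar> < (1/3)^J / 2"
      obtain c where c: "c \<in> F n" "x \<in> ball c (1 / Suc n)" using F(2)[of n] by blast
      have "indicator (A (idx c)) x = (indicator (A (idx c)) y :: real)"
        by (rule ternary_digits_eq[OF _ _ d[unfolded h_def] J[OF c(1)]])
           (auto split: split_indicator)
      then have "x \<in> A (idx c) \<longleftrightarrow> y \<in> A (idx c)" by (auto simp: indicator_def of_bool_def split: if_splits)
      then have "y \<in> ball c (1 / Suc n)" using c(2) unfolding idx[OF c(1)] by simp
      then have "dist c x < e / 2" "dist c y < e / 2" using c(2) n by (simp_all only: mem_ball)
      then show "dist x y < e" by (rule dist_triangle_half_r)
    qed auto
  qed
qed

text \<open>The hypothesis makes \<open>h\<close> injective with uniformly continuous inverse on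
  \<open>range h\<close>; compactness supplies the limits that extend the inverse to the closure. A
  closed domain is what Tietze's theorem asks for later.\<close>

lemma continuous_decoding:
  fixes h :: "'a::metric_space \<Rightarrow> real"
  assumes comp: "compact (UNIV :: 'a set)"
    and h: "\<And>e. e > 0 \<Longrightarrow> \<exists>d>0. \<forall>x y. \<bar>h x - h y\<bar> < d \<longrightarrow> dist x y < e"
  obtains p :: "real \<Rightarrow> 'a" where "continuous_on (closure (range h)) p" "\<And>x. p (h x) = x"
proof -
  let ?C = "closure (range h)"
  \<comment> \<open>The value at \<open>t\<close> is a cluster point of preimages of codes tending
    to \<open>t\<close>. It is described by approximation, which is all that the continuity proof
    uses.\<close>
  have "\<exists>x. \<forall>e>0. \<forall>d>0. \<exists>y. dist y x < e \<and> \<bar>h y - t\<bar> < d" if t: "t \<in> ?C" for t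
  proof -
    obtain u where u: "\<And>n. u n \<in> range h" "u \<longlonglongrightarrow> t"
      using t unfolding closure_sequential by blast
    have "\<forall>n. \<exists>y. u n = h y" using u(1) by blast
    then obtain z where z: "\<And>n. u n = h (z n)" by (auto dest!: choice)
    obtain x r where r: "strict_mono (r :: nat \<Rightarrow> nat)" "(z \<circ> r) \<longlonglongrightarrow> x"
      by (rule seq_compactE[OF compact_imp_seq_compact[OF comp], of z]) auto
    have "(u \<circ> r) \<longlonglongrightarrow> t" using u(2) r(1) by (rule LIMSEQ_subseq_LIMSEQ)
    have "\<exists>y. dist y x < e \<and> \<bar>h y - t\<bar> < d" if "e > 0" "d > 0" for e d
    proof -
      have "eventually (\<lambda>n. dist ((z \<circ> r) n) x < e \<and> dist ((u \<circ> r) n) t < d) sequentially"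
        using tendstoD[OF r(2) that(1)] tendstoD[OF \<open>(u \<circ> r) \<longlonglongrightarrow> t\<close> that(2)]
        by (rule eventually_conj)
      then obtain n where "dist ((z \<circ> r) n) x < e \<and> dist ((u \<circ> r) n) t < d"
        unfolding eventually_sequentially by blast
      then show ?thesis by (intro exI[of _ "z (r n)"]) (auto simp: z dist_real_def)
    qed
    then show ?thesis by blast
  qed
  then have "\<exists>p. \<forall>t\<in>?C. \<forall>e>0. \<forall>d>0. \<exists>y. dist y (p t) < e \<and> \<bar>h y - t\<bar> < d"
    by (intro bchoice) blast
  then obtain p where p: "\<And>t e d. t \<in> ?C \<Longrightarrow> e > 0 \<Longrightarrow> d > 0 \<Longrightarrow> \<exists>y. dist y (p t) < e \<and> \<bar>h y - t\<bar> < d"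
    by blast
  \<comment> \<open>\<open>p s\<close> and \<open>p t\<close> are compared through nearby points
    \<open>y\<close> and \<open>z\<close> whose codes are close to \<open>s\<close> and
    \<open>t\<close>; the three errors explain the thirds.\<close>
  have close: "\<exists>d>0. \<forall>s\<in>?C. \<forall>t\<in>?C. \<bar>s - t\<bar> < d \<longrightarrow> dist (p s) (p t) < e" if "e > 0" for e
  proof -
    obtain d where d: "d > 0" "\<And>x y. \<bar>h x - h y\<bar> < d \<Longrightarrow> dist x y < e/3"
      using h[of "e/3"] \<open>e > 0\<close> by (metis divide_pos_pos zero_less_numeral)
    have "dist (p s) (p t) < e" if st: "s \<in> ?C" "t \<in> ?C" "\<bar>s - t\<bar> < d/3" for s t
    proof -
      obtain y where y: "dist y (p s) < e/3" "\<bar>h y - s\<bar> < d/3" using p[of s "e/3" "d/3"] st d(1) \<open>e > 0\<close> by auto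
      obtain z where z: "dist z (p t) < e/3" "\<bar>h z - t\<bar> < d/3" using p[of t "e/3" "d/3"] st d(1) \<open>e > 0\<close> by auto
      have "\<bar>h y - h z\<bar> < d" using y z st by linarith
      then have "dist y z < e/3" by (rule d(2))
      moreover have "dist (p s) (p t) \<le> dist y (p s) + dist y z + dist z (p t)"
        using dist_triangle[of "p s" "p t" y] dist_triangle[of y "p t" z] by (simp add: dist_commute)
      ultimately show ?thesis using y z by linarith
    qed
    with d(1) show ?thesis by (intro exI[of _ "d/3"]) auto
  qed
  show thesis
  proof
    show "continuous_on ?C p"
      unfolding continuous_on_iff
    proof (intro ballI allI impI)
      fix t e :: real assume "t \<in> ?C" "e > 0"
      then show "\<exists>d>0. \<forall>s\<in>?C. dist s t < d \<longrightarrow> dist (p s) (p t) < e"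
        using close[of e] by (auto simp: dist_real_def)
    qed
    fix x
    have hx: "h x \<in> ?C" by (meson closure_subset rangeI subsetD)
    have "dist x (p (h x)) \<le> e" if "e > 0" for e
    proof -
      obtain d where d: "d > 0" "\<And>x y. \<bar>h x - h y\<bar> < d \<Longrightarrow> dist x y < e/2"
        using h[of "e/2"] \<open>e > 0\<close> by (metis half_gt_zero)
      obtain y where "dist y (p (h x)) < e/2" "\<bar>h y - h x\<bar> < d"
        using p[OF hx, of "e/2" d] d(1) \<open>e > 0\<close> by auto
      then have "dist y (p (h x)) < e/2" "dist y x < e/2" using d(2) by auto
      then show ?thesis using dist_triangle_half_r[of y x e "p (h x)"] by auto
    qed
    then have "dist x (p (h x)) \<le> 0" by (rule field_le_epsilon[of _ 0, simplified])
    then show "p (h x) = x" by simp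
  qed
qed

text \<open>The measures are pushed to the line by the Borel code \<open>h\<close>, Helly's theorem
  gives a weak limit there, and the decoding map pulls it back. The limit is concentrated on the
  closure of \<open>range h\<close>, where decoding is continuous.\<close>

lemma sequentially_compact_Xi:
  fixes \<mu> :: "nat \<Rightarrow> 'a::metric_space measure"
  assumes comp: "compact (UNIV :: 'a set)" and \<mu>: "\<And>n. \<mu> n \<in> Xi UNIV"
  obtains r \<nu> where "strict_mono (r :: nat \<Rightarrow> nat)" "limitin weak_topology (\<mu> \<circ> r) \<nu> sequentially"
proof -
  obtain h :: "'a \<Rightarrow> real" where hm: "h \<in> borel_measurable borel" and h02: "\<And>x. h x \<in> {0..2}"
    and hd: "\<And>e. e > 0 \<Longrightarrow> \<exists>d>0. \<forall>x y. \<bar>h x - h y\<bar> < d \<longrightarrow> dist x y < e"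
    using compact_metric_encoding[OF comp] by blast
  obtain p where p: "continuous_on (closure (range h)) p" "\<And>x. p (h x) = x"
    using continuous_decoding[OF comp hd] by blast
  define C where "C = closure (range h)"
  have C: "closed C" "C \<noteq> {}" "\<And>x. h x \<in> C" 
    by (auto simp: C_def closure_subset[THEN subsetD])
  have ps: "prob_space (\<mu> n)" and ss: "sets (\<mu> n) = sets borel" for n
    using \<mu>[of n] by (auto simp: Xi_def)
  have hm': "h \<in> borel_measurable (\<mu> n)" for n
    using hm measurable_cong_sets[OF ss refl] by blast
  define M where "M n = distr (\<mu> n) borel h" for n
  have rd: "real_distribution (M n)" for n
    unfolding M_def by (rule prob_space.real_distribution_distr[OF ps hm'])
  \<comment> \<open>All codes lie in \<open>{0..2}\<close>, so one interval carries full mass for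
    every \<open>n\<close>, whatever \<open>e\<close> is.\<close>
  have "tight M"
    unfolding tight_def
  proof (intro conjI allI impI rd)
    fix e :: real assume "e > 0"
    have "measure (M n) {-1<..3} = 1" for n
    proof -
      have "measure (M n) {-1<..3} = measure (\<mu> n) (h -` {-1<..3} \<inter> space (\<mu> n))"
        unfolding M_def by (rule measure_distr[OF hm']) auto
      also have "h -` {-1<..3} = UNIV"
      proof -
        have "-1 < h x \<and> h x \<le> 3" for x using h02[of x] by auto
        then show ?thesis by auto
      qed
      finally show ?thesis using prob_space.prob_space[OF ps[of n]] by simp
    qed
    then show "\<exists>a b. a < b \<and> (\<forall>n. 1 - e < measure (M n) {a<..b})"
      using \<open>e > 0\<close> by (intro exI[of _ "-1"] exI[of _ 3]) auto
  qed
  then obtain r N where r: "strict_mono r" and N: "real_distribution N" and "weak_conv_m (M \<circ> id \<circ> r) N"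
    using tight_imp_convergent_subsubsequence[of M id] by (auto simp: strict_mono_id)
  then have wc: "weak_conv_m (\<lambda>n. M (r n)) N" by (simp add: comp_def)
  interpret N: real_distribution N by (rule N)
  have int_conv: "(\<lambda>n. \<integral>x. g (h x) \<partial>\<mu> (r n)) \<longlonglongrightarrow> (\<integral>t. g t \<partial>N)"
    if g: "continuous_on UNIV g" "\<And>t. norm (g t) \<le> B" for g :: "real \<Rightarrow> real" and B
  proof -
    have "(\<lambda>n. \<integral>t. g t \<partial>M (r n)) \<longlonglongrightarrow> (\<integral>t. g t \<partial>N)"
      using weak_conv_imp_integral_bdd_continuous_conv[OF rd N wc, of g B] g
      by (auto simp: continuous_on_eq_continuous_at)
    moreover have "(\<integral>t. g t \<partial>M (r n)) = (\<integral>x. g (h x) \<partial>\<mu> (r n))" for n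
      unfolding M_def by (rule integral_distr[OF hm'])
        (use g(1) in \<open>auto intro: borel_measurable_continuous_onI\<close>)
    ultimately show ?thesis by simp
  qed
  \<comment> \<open>The truncated distance to \<open>C\<close> is a bounded continuous test function
    whose integrals vanish along the sequence, hence also in the limit; closedness of
    \<open>C\<close> does the rest.\<close>
  have NC: "AE t in N. t \<in> C"
  proof -
    let ?g = "\<lambda>t. min 1 (infdist t C)"
    have g: "continuous_on UNIV ?g" by (intro continuous_intros)
    have "(\<lambda>n. \<integral>x. ?g (h x) \<partial>\<mu> (r n)) \<longlonglongrightarrow> (\<integral>t. ?g t \<partial>N)"
      by (rule int_conv[OF g, of 1]) (auto simp: infdist_nonneg)
    then have "(\<lambda>n. 0) \<longlonglongrightarrow> (\<integral>t. ?g t \<partial>N)" using C by simp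
    then have 0: "(\<integral>t. ?g t \<partial>N) = 0" by (simp add: LIMSEQ_const_iff)
    have gm: "?g \<in> borel_measurable N"
      using borel_measurable_continuous_onI[OF g] measurable_cong_sets[OF N.events_eq_borel refl] by blast
    have "integrable N ?g"
      by (rule N.integrable_const_bound[of _ 1]) (use gm in \<open>auto simp: infdist_nonneg\<close>)
    then have "AE t in N. ?g t = 0"
      using integral_nonneg_eq_0_iff_AE[of N ?g] 0 by (auto simp: infdist_nonneg)
    then show ?thesis
      by eventually_elim (use C in \<open>auto simp: in_closed_iff_infdist_zero min_def split: if_splits\<close>)
  qed
  \<comment> \<open>Off \<open>C\<close>, a null set for \<open>N\<close>, an arbitrary constant
    keeps \<open>q\<close> Borel measurable.\<close>
  define q where "q t = (if t \<in> C then p t else undefined)" for t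
  have qm: "q \<in> borel_measurable borel"
    unfolding q_def using C p(1) by (intro borel_measurable_continuous_on_if) (auto simp: C_def)
  then have qmN: "q \<in> borel_measurable N" using measurable_cong_sets[OF N.events_eq_borel refl] by blast
  define \<nu> where "\<nu> = distr N borel q"
  have \<nu>: "\<nu> \<in> Xi UNIV"
    unfolding Xi_UNIV \<nu>_def using N.prob_space_distr[OF qmN] by simp
  have "limitin weak_topology (\<mu> \<circ> r) \<nu> sequentially"
  proof (rule limitin_weak_topologyI[OF \<nu>])
    show "\<forall>\<^sub>F n in sequentially. (\<mu> \<circ> r) n \<in> Xi UNIV" using \<mu> by simp
    fix f :: "'a \<Rightarrow> real" assume f: "continuous_on UNIV f" "bounded (range f)"
    obtain B where B: "\<And>x. \<bar>f x\<bar> \<le> B" using f(2) unfolding bounded_iff by auto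
    have "0 \<le> B" using B[of undefined] by linarith
    have "continuous_on C (\<lambda>t. f (p t))"
      using continuous_on_compose2[OF f(1) p(1)] by (simp add: C_def)
    \<comment> \<open>Tietze's theorem extends the composition of \<open>f\<close> and
      \<open>p\<close> to the line with the same bound. As \<open>p (h x) = x\<close>, the identity
      \<open>g (h x) = f x\<close> holds even where \<open>h\<close> is discontinuous.\<close>
    then obtain g where g: "continuous_on UNIV g" "\<And>t. t \<in> C \<Longrightarrow> g t = f (p t)" "\<And>t. norm (g t) \<le> B"
      using Tietze[of C "\<lambda>t. f (p t)" UNIV B] B \<open>0 \<le> B\<close> C(1) by auto
    have "(\<integral>t. g t \<partial>N) = (\<integral>t. f (q t) \<partial>N)"
    proof (rule integral_cong_AE)
      show "g \<in> borel_measurable N"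
        using borel_measurable_continuous_onI[OF g(1)] measurable_cong_sets[OF N.events_eq_borel refl] by blast
      show "(\<lambda>t. f (q t)) \<in> borel_measurable N"
        using measurable_compose[OF qmN borel_measurable_continuous_onI[OF f(1)]] .
      show "AE t in N. g t = f (q t)" using NC by eventually_elim (simp add: g q_def)
    qed
    also have "\<dots> = (\<integral>x. f x \<partial>\<nu>)"
      unfolding \<nu>_def by (rule integral_distr[symmetric, OF qmN]) (rule borel_measurable_continuous_onI[OF f(1)])
    finally show "(\<lambda>n. \<integral>x. f x \<partial>(\<mu> \<circ> r) n) \<longlonglongrightarrow> (\<integral>x. f x \<partial>\<nu>)"
      using int_conv[OF g(1,3)] g(2)[OF C(3)] p(2) by (simp add: comp_def)
  qed
  with r that show thesis by blast
qed

section \<open>Elementary facts and Dirac measures\<close>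

lemma XiD:
  assumes "\<xi> \<in> Xi S"
  shows "sets \<xi> = sets borel" "prob_space \<xi>" "space \<xi> = UNIV" "emeasure \<xi> (- S) = 0"
  using assms by (auto simp: Xi_def dest: sets_eq_imp_space_eq)

lemma Xi_subset_UNIV: "Xi S \<subseteq> Xi UNIV"
  by (auto simp: Xi_def)

lemma return_in_Xi:
  assumes "S \<in> sets borel" "x \<in> S"
  shows "return borel x \<in> Xi S"
  using assms by (auto simp: Xi_def intro!: prob_space_return split: split_indicator)

text \<open>Integrating \<open>f\<close> against a Dirac measure evaluates \<open>f\<close>. Through
  this, weak continuity of \<Psi> becomes continuity of its values on Dirac measures.\<close>

lemma limitin_return:
  fixes x :: "'a::metric_space"
  assumes "(u \<longlongrightarrow> x) F"
  shows "limitin weak_topology (\<lambda>n. return borel (u n)) (return borel x) F"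
proof (rule limitin_weak_topologyI)
  fix f :: "'a \<Rightarrow> real" assume f: "continuous_on UNIV f"
  have "(\<integral>x. f x \<partial>return borel y) = f y" for y
    by (rule integral_return) (use f in \<open>auto intro: borel_measurable_continuous_onI\<close>)
  moreover have "((\<lambda>n. f (u n)) \<longlongrightarrow> f x) F"
    by (rule continuous_on_tendsto_compose[OF f assms]) auto
  ultimately show "((\<lambda>n. \<integral>x. f x \<partial>return borel (u n)) \<longlongrightarrow> (\<integral>x. f x \<partial>return borel x)) F"
    by simp
qed (simp_all add: return_in_Xi)

section \<open>Affine functions of measures\<close>

lemma measure_mix:
  assumes "\<xi> \<in> Xi S" "\<eta> \<in> Xi T" "A \<in> sets borel" "0 \<le> \<alpha>" "\<alpha> \<le> 1"
  shows "measure (mix \<xi> \<eta> \<alpha>) A = (1 - \<alpha>) * measure \<xi> A + \<alpha> * measure \<eta> A"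
proof -
  interpret \<xi>: prob_space \<xi> by (rule XiD[OF assms(1)])
  interpret \<eta>: prob_space \<eta> by (rule XiD[OF assms(2)])
  have "emeasure (mix \<xi> \<eta> \<alpha>) A = ennreal ((1 - \<alpha>) * measure \<xi> A + \<alpha> * measure \<eta> A)"
    using assms(4,5) XiD(1)[OF assms(1)] XiD(1)[OF assms(2)] assms(3)
    by (simp add: emeasure_mix \<xi>.emeasure_eq_measure \<eta>.emeasure_eq_measure ennreal_mult)
  then show ?thesis using assms(4,5) by (intro measure_eq_emeasure_eq_ennreal) auto
qed

lemma affine_on_Xi_real:
  assumes "affine_on_Xi \<Psi>" "real_valued_on_Xi \<Psi>" "\<xi> \<in> Xi UNIV" "\<eta> \<in> Xi UNIV" "0 \<le> \<alpha>" "\<alpha> \<le> 1"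
  shows "real_of_ereal (\<Psi> (mix \<xi> \<eta> \<alpha>)) =
    (1 - \<alpha>) * real_of_ereal (\<Psi> \<xi>) + \<alpha> * real_of_ereal (\<Psi> \<eta>)"
proof -
  obtain a b where "\<Psi> \<xi> = ereal a" "\<Psi> \<eta> = ereal b"
    using assms(2-4) unfolding real_valued_on_Xi_def by (metis ereal_real')
  then show ?thesis using assms unfolding affine_on_Xi_def by auto
qed

text \<open>Affinity speaks of two-point mixtures only, so atoms are split off one at a time, by
  induction on the support.\<close>

lemma affine_finite_support:
  fixes \<Psi> :: "'a::metric_space measure \<Rightarrow> ereal"
  assumes aff: "affine_on_Xi \<Psi>" and rv: "real_valued_on_Xi \<Psi>"
    and "finite S" "\<xi> \<in> Xi S"
  shows "real_of_ereal (\<Psi> \<xi>) = (\<Sum>x\<in>S. measure \<xi> {x} * real_of_ereal (\<Psi> (return borel x)))"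
  using assms(3,4)
proof (induction S arbitrary: \<xi> rule: finite_induct)
  case empty
  \<comment> \<open>No probability measure is concentrated on the empty set.\<close>
  have "emeasure \<xi> UNIV = 1"
    using prob_space.emeasure_space_1[OF XiD(2)[OF empty]] XiD(3)[OF empty] by simp
  with empty show ?case by (simp add: Xi_def)
next
  case (insert x S)
  note \<xi> = XiD[OF insert.prems]
  interpret \<xi>: prob_space \<xi> by (rule \<xi>)
  define p where "p = measure \<xi> {x}"
  have [measurable]: "A \<in> sets \<xi>" if "A \<in> sets borel" for A using that \<xi>(1) by simp
  have bS: "S \<in> sets borel" "insert x S \<in> sets borel"
    using insert.hyps(1) by (auto intro: borel_closed finite_imp_closed)
  have p: "0 \<le> p" "p \<le> 1" by (auto simp: p_def)
  have compl: "measure \<xi> (- {x}) = 1 - p"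
    using \<xi>.prob_compl[of "{x}"] \<xi>(1,3) by (simp add: p_def Compl_eq_Diff_UNIV)
  have rx: "return borel x \<in> Xi UNIV" by (rule return_in_Xi) auto
  show ?case
  \<comment> \<open>If the atom at \<open>x\<close> has full mass, conditioning on its complement is
    impossible; then \<xi> is the Dirac measure at \<open>x\<close>.\<close>
  proof (cases "p = 1")
    case True
    then have 0: "measure \<xi> (- {x}) = 0" using compl by simp
    have z: "measure \<xi> {y} = 0" if "y \<in> S" for y
    proof -
      have "measure \<xi> {y} \<le> measure \<xi> (- {x})"
        using that insert.hyps(2) \<xi>(1) by (intro \<xi>.finite_measure_mono) auto
      then show ?thesis using 0 measure_nonneg[of \<xi> "{y}"] by linarith
    qed
    have "\<xi> = return borel x"
    proof (rule measure_eqI)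
      fix A assume A: "A \<in> sets \<xi>"
      have "measure \<xi> A = indicator A x"
      proof (cases "x \<in> A")
        case True
        then have "1 \<le> measure \<xi> A" 
          using \<xi>.finite_measure_mono[of "{x}" A] A \<open>p = 1\<close> by (auto simp: p_def)
        then show ?thesis using True by (auto intro: antisym)
      next
        case False
        then have "measure \<xi> A \<le> measure \<xi> (- {x})"
          using A \<xi>(1) by (intro \<xi>.finite_measure_mono) auto
        then show ?thesis using False 0 measure_nonneg[of \<xi> A] by simp
      qed
      then show "emeasure \<xi> A = emeasure (return borel x) A"
        using A \<xi>(1) by (simp add: \<xi>.emeasure_eq_measure split: split_indicator)
    qed (simp add: \<xi>(1))
    then show ?thesis using insert.hyps z True by (simp add: p_def)
  next
    case False
    \<comment> \<open>This is \<xi> conditioned on the complement of \<open>x\<close>. It is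
      concentrated on \<open>S\<close>, and \<xi> is its mixture with the Dirac measure at
      \<open>x\<close> of weight \<open>p\<close>.\<close>
    define \<eta> where "\<eta> = uniform_measure \<xi> (- {x})"
    have ne: "emeasure \<xi> (- {x}) \<noteq> 0" "emeasure \<xi> (- {x}) \<noteq> \<infinity>"
      using False compl p by (auto simp: \<xi>.emeasure_eq_measure)
    have \<eta>_eq: "measure \<eta> A = measure \<xi> (A - {x}) / (1 - p)" if "A \<in> sets borel" for A
    proof -
      have "- {x} \<inter> A = A - {x}" by auto
      then show ?thesis unfolding \<eta>_def using measure_uniform_measure[OF ne, of A] that \<xi>(1) compl by simp
    qed
    have sz: "emeasure \<xi> (- insert x S) = 0" by (rule \<xi>)
    have \<eta>: "\<eta> \<in> Xi S"
      unfolding Xi_def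
    proof (intro CollectI conjI)
      show "sets \<eta> = sets borel" unfolding \<eta>_def using \<xi>(1) by simp
      show ps: "prob_space \<eta>" unfolding \<eta>_def by (rule prob_space_uniform_measure[OF ne])
      have "- S - {x} = - insert x S" by auto
      then have "measure \<eta> (- S) = 0" using sz bS by (subst \<eta>_eq) (auto simp: measure_def)
      then show "emeasure \<eta> (- S) = 0"
        using finite_measure.emeasure_eq_measure[OF prob_space.finite_measure[OF ps]] by simp
    qed
    have \<eta>U: "\<eta> \<in> Xi UNIV" using \<eta> Xi_subset_UNIV by auto
    interpret \<eta>: prob_space \<eta> by (rule XiD[OF \<eta>])
    have "\<xi> = mix \<eta> (return borel x) p"
    proof (rule measure_eqI)
      fix A assume "A \<in> sets \<xi>"
      then have A: "A \<in> sets borel" using \<xi>(1) by simp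
      have mX: "mix \<eta> (return borel x) p \<in> Xi UNIV" by (rule mix_in_Xi[OF \<eta>U rx _ p]) auto
      interpret m: prob_space "mix \<eta> (return borel x) p" by (rule XiD[OF mX])
      have "measure \<xi> A = measure \<xi> (A - {x}) + indicator A x * p"
      proof (cases "x \<in> A")
        case True
        then have "A = (A - {x}) \<union> {x}" by auto
        then show ?thesis using True \<xi>.finite_measure_Union[of "A - {x}" "{x}"] A \<xi>(1) by (auto simp: p_def)
      qed auto
      then have "measure (mix \<eta> (return borel x) p) A = measure \<xi> A"
        using False p by (simp add: measure_mix[OF \<eta>U rx A] \<eta>_eq[OF A] measure_return A)
      then show "emeasure \<xi> A = emeasure (mix \<eta> (return borel x) p) A"
        by (simp add: \<xi>.emeasure_eq_measure m.emeasure_eq_measure)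
    qed (simp add: \<xi>(1))
    then have "real_of_ereal (\<Psi> \<xi>) =
      (1 - p) * real_of_ereal (\<Psi> \<eta>) + p * real_of_ereal (\<Psi> (return borel x))"
      using affine_on_Xi_real[OF aff rv \<eta>U rx p] by simp
    also have "real_of_ereal (\<Psi> \<eta>) = (\<Sum>y\<in>S. measure \<eta> {y} * real_of_ereal (\<Psi> (return borel y)))"
      by (rule insert.IH[OF \<eta>])
    also have "\<dots> = (\<Sum>y\<in>S. measure \<xi> {y} * real_of_ereal (\<Psi> (return borel y))) / (1 - p)"
    proof -
      have "{y} - {x} = {y}" if "y \<in> S" for y using that insert.hyps by auto
      then show ?thesis by (simp add: \<eta>_eq sum_divide_distrib)
    qed
    finally show ?thesis using insert.hyps False by (simp add: p_def)
  qed
qed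

section \<open>Integral representation of continuous affine functions\<close>

text \<open>Each point is sent to the first centre of a finite \<open>e\<close>-net within distance
  \<open>e\<close>; choosing the least index makes the map measurable.\<close>

lemma discretizing_map:
  fixes e :: real
  assumes comp: "compact (UNIV :: 'a::metric_space set)" and "e > 0"
  obtains q :: "'a::metric_space \<Rightarrow> 'a" where "q \<in> borel_measurable borel" "finite (range q)" "\<And>x. dist (q x) x < e"
proof -
  obtain F :: "'a set" where F: "finite F" "UNIV \<subseteq> (\<Union>c\<in>F. ball c e)"
    using compact_eq_totally_bounded[of "UNIV :: 'a set"] comp \<open>e > 0\<close> by blast
  obtain c n where c: "F = c ` {i::nat. i < n}"
    using finite_imp_nat_seg_image_inj_on[OF F(1)] by blast
  define j where "j x = (LEAST i. dist (c i) x < e)" for x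
  have ex: "\<exists>i<n. dist (c i) x < e" for x
  proof -
    have "x \<in> (\<Union>c\<in>F. ball c e)" using F(2) by blast
    then show ?thesis using c by auto
  qed
  have jd: "dist (c (j x)) x < e" for x
    unfolding j_def by (rule LeastI_ex) (use ex in auto)
  have jn: "j x < n" for x
    using ex[of x] Least_le[of "\<lambda>i. dist (c i) x < e"] unfolding j_def by (meson le_less_trans)
  have jm: "j \<in> measurable borel (count_space UNIV)"
    unfolding j_def
  proof (rule measurable_Least)
    fix i
    have "{x. dist (c i) x < e} \<in> sets borel" using borel_open[OF open_ball[of "c i" e]] by (simp add: ball_def)
    then show "(\<lambda>x. dist (c i) x < e) \<in> measurable borel (count_space UNIV)"
      by (simp add: pred_def)
  qed
  show thesis
  proof
    show "(\<lambda>x. c (j x)) \<in> borel_measurable borel"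
      by (rule measurable_compose[OF jm]) simp
    have "range (\<lambda>x. c (j x)) \<subseteq> F" using jn c by auto
    then show "finite (range (\<lambda>x. c (j x)))" using F(1) finite_subset by blast
  qed (rule jd)
qed

lemma continuous_return_value:
  fixes \<Psi> :: "'a::metric_space measure \<Rightarrow> ereal"
  assumes "continuous_map weak_topology euclideanreal (\<lambda>\<xi>. real_of_ereal (\<Psi> \<xi>))"
  shows "continuous_on UNIV (\<lambda>x. real_of_ereal (\<Psi> (return borel x)))"
  unfolding continuous_on_def
proof
  fix x :: 'a
  show "((\<lambda>x. real_of_ereal (\<Psi> (return borel x))) \<longlongrightarrow> real_of_ereal (\<Psi> (return borel x))) (at x)"
    using continuous_map_limit[OF assms limitin_return[OF tendsto_ident_at[of x UNIV]]] by (simp add: comp_def)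
qed

text \<open>The formula is known for finitely supported measures. The images of \<eta> under finer
  and finer discretizing maps are of this kind and converge weakly to \<eta>, and both sides pass to
  the limit.\<close>

lemma affine_integral_representation:
  fixes \<Psi> :: "'a::metric_space measure \<Rightarrow> ereal"
  assumes comp: "compact (UNIV :: 'a set)"
    and aff: "affine_on_Xi \<Psi>" and rv: "real_valued_on_Xi \<Psi>"
    and cont: "continuous_map weak_topology euclideanreal (\<lambda>\<xi>. real_of_ereal (\<Psi> \<xi>))"
    and \<eta>: "\<eta> \<in> Xi UNIV"
  shows "integrable \<eta> (\<lambda>x. real_of_ereal (\<Psi> (return borel x)))"
    and "(\<integral>x. real_of_ereal (\<Psi> (return borel x)) \<partial>\<eta>) = real_of_ereal (\<Psi> \<eta>)"
proof -
  interpret prob_space \<eta> by (rule XiD[OF \<eta>])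
  have m\<eta>: "f \<in> borel_measurable \<eta>" if "f \<in> borel_measurable borel" for f :: "'a \<Rightarrow> 'b::topological_space"
    using that measurable_cong_sets[OF XiD(1)[OF \<eta>] refl] by blast
  define g where "g x = real_of_ereal (\<Psi> (return borel x))" for x
  have g: "continuous_on UNIV g" unfolding g_def by (rule continuous_return_value[OF cont])
  have gm: "g \<in> borel_measurable borel" by (rule borel_measurable_continuous_onI[OF g])
  have cb: "\<exists>B. \<forall>x. \<bar>f x\<bar> \<le> B" if "continuous_on UNIV f" for f :: "'a \<Rightarrow> real"
    using compact_imp_bounded[OF compact_continuous_image[OF that comp]] unfolding bounded_iff by auto
  obtain B where B: "\<And>x. \<bar>g x\<bar> \<le> B" using cb[OF g] by blast
  show "integrable \<eta> (\<lambda>x. real_of_ereal (\<Psi> (return borel x)))"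
    unfolding g_def[symmetric] by (rule integrable_const_bound[of _ B]) (use B m\<eta>[OF gm] in auto)
  have "\<exists>q :: 'a \<Rightarrow> 'a. q \<in> borel_measurable borel \<and> finite (range q) \<and> (\<forall>x. dist (q x) x < inverse (Suc n))" for n
    using discretizing_map[OF comp, of "inverse (Suc n)"] by (metis inverse_positive_iff_positive of_nat_0_less_iff zero_less_Suc)
  then obtain q :: "nat \<Rightarrow> 'a \<Rightarrow> 'a" where qm: "\<And>n. q n \<in> borel_measurable borel" 
    and qf: "\<And>n. finite (range (q n))" and qd: "\<And>n x. dist (q n x) x < inverse (Suc n)"
    by metis
  have qlim: "(\<lambda>n. q n x) \<longlonglongrightarrow> x" for x
  proof (rule metric_tendsto_imp_tendsto[OF LIMSEQ_inverse_real_of_nat])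
    show "\<forall>\<^sub>F n in sequentially. dist (q n x) x \<le> dist (inverse (real (Suc n))) 0"
      using qd[THEN less_imp_le] by (auto simp: dist_real_def intro!: always_eventually)
  qed
  define \<mu> where "\<mu> n = distr \<eta> borel (q n)" for n
  have \<mu>: "\<mu> n \<in> Xi (range (q n))" for n
  proof -
    have cl: "range (q n) \<in> sets borel" using qf by (auto intro: borel_closed finite_imp_closed)
    have "emeasure (\<mu> n) (- range (q n)) = 0"
    proof -
      have "q n -` (- range (q n)) = {}" by auto
      then show ?thesis unfolding \<mu>_def using cl by (subst emeasure_distr[OF m\<eta>[OF qm]]) auto
    qed
    then show ?thesis unfolding Xi_def using prob_space_distr[OF m\<eta>[OF qm]] by (simp add: \<mu>_def)
  qed
  have int_conv: "(\<lambda>n. \<integral>x. f (q n x) \<partial>\<eta>) \<longlonglongrightarrow> (\<integral>x. f x \<partial>\<eta>)" if f: "continuous_on UNIV f" for f :: "'a \<Rightarrow> real"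
  proof -
    obtain B where B: "\<And>x. \<bar>f x\<bar> \<le> B" using cb[OF f] by blast
    have fm: "f \<in> borel_measurable borel" by (rule borel_measurable_continuous_onI[OF f])
    show ?thesis
    proof (rule integral_dominated_convergence[of _ _ _ "\<lambda>_. B"])
      show "(\<lambda>x. f (q n x)) \<in> borel_measurable \<eta>" for n
        by (rule m\<eta>[OF measurable_compose[OF qm fm]])
      show "AE x in \<eta>. (\<lambda>n. f (q n x)) \<longlonglongrightarrow> f x"
        using continuous_on_tendsto_compose[OF f qlim] by auto
    qed (use B m\<eta>[OF fm] in auto)
  qed
  have int_\<mu>: "(\<integral>x. f x \<partial>\<mu> n) = (\<integral>x. f (q n x) \<partial>\<eta>)" if "f \<in> borel_measurable borel" for f :: "'a \<Rightarrow> real" and n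
    unfolding \<mu>_def by (rule integral_distr[OF m\<eta>[OF qm] that])
  have "limitin weak_topology \<mu> \<eta> sequentially"
  proof (rule limitin_weak_topologyI[OF \<eta>])
    show "\<forall>\<^sub>F n in sequentially. \<mu> n \<in> Xi UNIV"
      using \<mu> Xi_subset_UNIV by (intro always_eventually) blast
    fix f :: "'a \<Rightarrow> real" assume "continuous_on UNIV f"
    then show "(\<lambda>n. \<integral>x. f x \<partial>\<mu> n) \<longlonglongrightarrow> (\<integral>x. f x \<partial>\<eta>)"
      using int_conv[of f] int_\<mu>[of f] by (simp add: borel_measurable_continuous_onI)
  qed
  then have lim1: "(\<lambda>n. real_of_ereal (\<Psi> (\<mu> n))) \<longlonglongrightarrow> real_of_ereal (\<Psi> \<eta>)"
    using continuous_map_limit[OF cont] by (simp add: comp_def)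
  have "real_of_ereal (\<Psi> (\<mu> n)) = (\<integral>x. g (q n x) \<partial>\<eta>)" for n
  proof -
    have meas: "q n -` {y} \<in> sets \<eta>" for y
      using measurable_sets[OF m\<eta>[OF qm[of n]], of "{y}"] XiD(3)[OF \<eta>] by simp
    \<comment> \<open>The atoms of \<open>\<mu> n\<close> are the \<eta>-masses of the fibres of
      \<open>q n\<close>, so the finite sum is the integral of a simple function.\<close>
    have "real_of_ereal (\<Psi> (\<mu> n)) = (\<Sum>y\<in>range (q n). measure (\<mu> n) {y} * g y)"
      unfolding g_def by (rule affine_finite_support[OF aff rv qf \<mu>])
    also have "\<dots> = (\<Sum>y\<in>range (q n). (\<integral>x. indicator (q n -` {y}) x * g y \<partial>\<eta>))"
      using meas XiD(3)[OF \<eta>] by (intro sum.cong refl) (simp add: \<mu>_def measure_distr[OF m\<eta>[OF qm]])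
    also have "\<dots> = (\<integral>x. (\<Sum>y\<in>range (q n). indicator (q n -` {y}) x * g y) \<partial>\<eta>)"
      using meas by (intro Bochner_Integration.integral_sum[symmetric]) (auto intro!: integrable_real_indicator simp: emeasure_eq_measure)
    also have "\<dots> = (\<integral>x. g (q n x) \<partial>\<eta>)"
    proof (rule Bochner_Integration.integral_cong[OF refl])
      fix x
      have "(\<Sum>y\<in>range (q n). indicator (q n -` {y}) x * g y) = (\<Sum>y\<in>range (q n). if y = q n x then g y else 0)"
        by (intro sum.cong) (auto split: split_indicator)
      then show "(\<Sum>y\<in>range (q n). indicator (q n -` {y}) x * g y) = g (q n x)"
        using qf[of n] by simp
    qed
    finally show ?thesis .
  qed
  then have "(\<lambda>n. real_of_ereal (\<Psi> (\<mu> n))) \<longlonglongrightarrow> (\<integral>x. g x \<partial>\<eta>)" using int_conv[OF g] by simp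
  with lim1 show "(\<integral>x. real_of_ereal (\<Psi> (return borel x)) \<partial>\<eta>) = real_of_ereal (\<Psi> \<eta>)"
    unfolding g_def by (rule LIMSEQ_unique[symmetric])
qed

section \<open>Directional derivatives\<close>

lemma dom_ereal:
  assumes "proper_on_Xi \<Psi>" "\<xi> \<in> dom \<Psi>"
  shows "\<Psi> \<xi> = ereal (real_of_ereal (\<Psi> \<xi>))"
  using assms unfolding proper_on_Xi_def dom_def by (cases "\<Psi> \<xi>") auto

lemma eventually_at_right_0_unit: "eventually (\<lambda>\<alpha>::real. 0 < \<alpha> \<and> \<alpha> < 1) (at_right 0)"
  using eventually_at_right_real[of 0 "1::real"] by (auto elim: eventually_mono)

text \<open>A real limit of the extended real quotients excludes the value \<infinity> close to 0;
  from there on the quotients are those of real numbers.\<close>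

lemma sensitivity_function_real:
  fixes \<Psi> :: "'a::topological_space measure \<Rightarrow> ereal"
  assumes proper: "proper_on_Xi \<Psi>" and sens: "sensitivity_function \<Psi> \<psi>"
    and \<xi>: "\<xi> \<in> dom \<Psi>" and \<eta>: "\<eta> \<in> Xi UNIV"
  shows "eventually (\<lambda>\<alpha>. mix \<xi> \<eta> \<alpha> \<in> dom \<Psi>) (at_right 0)"
    and "((\<lambda>\<alpha>. (real_of_ereal (\<Psi> (mix \<xi> \<eta> \<alpha>)) - real_of_ereal (\<Psi> \<xi>)) / \<alpha>) \<longlongrightarrow>
      (\<integral>x. \<psi> \<xi> x \<partial>\<eta>)) (at_right 0)"
proof -
  let ?q = "\<lambda>\<alpha>. (\<Psi> (mix \<xi> \<eta> \<alpha>) - \<Psi> \<xi>) / ereal \<alpha>"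
  let ?L = "\<integral>x. \<psi> \<xi> x \<partial>\<eta>"
  obtain a where a: "\<Psi> \<xi> = ereal a" using dom_ereal[OF proper \<xi>] by blast
  have \<xi>X: "\<xi> \<in> Xi UNIV" using \<xi> by (simp add: dom_def)
  have lim: "(?q \<longlongrightarrow> ereal ?L) (at_right 0)"
    using sens \<xi> \<eta> unfolding sensitivity_function_def by blast
  \<comment> \<open>Any real upper bound serves; the margin 1 is arbitrary.\<close>
  then have "eventually (\<lambda>\<alpha>. ?q \<alpha> < ereal (?L + 1)) (at_right 0)"
    by (rule order_tendstoD) simp
  with eventually_at_right_0_unit
  show ev: "eventually (\<lambda>\<alpha>. mix \<xi> \<eta> \<alpha> \<in> dom \<Psi>) (at_right 0)"
  proof eventually_elim
    case (elim \<alpha>)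
    have "mix \<xi> \<eta> \<alpha> \<in> Xi UNIV" using elim by (intro mix_in_Xi \<xi>X \<eta>) auto
    moreover have "\<Psi> (mix \<xi> \<eta> \<alpha>) \<noteq> \<infinity>" using elim a by auto
    ultimately show ?case by (simp add: dom_def less_top[symmetric])
  qed
  with eventually_at_right_0_unit
  have "eventually (\<lambda>\<alpha>. ?q \<alpha> = ereal ((real_of_ereal (\<Psi> (mix \<xi> \<eta> \<alpha>)) - real_of_ereal (\<Psi> \<xi>)) / \<alpha>)) (at_right 0)"
  proof eventually_elim
    case (elim \<alpha>)
    then obtain b where "\<Psi> (mix \<xi> \<eta> \<alpha>) = ereal b" using dom_ereal[OF proper] by blast
    with a elim show ?case by simp
  qed
  with lim show "((\<lambda>\<alpha>. (real_of_ereal (\<Psi> (mix \<xi> \<eta> \<alpha>)) - real_of_ereal (\<Psi> \<xi>)) / \<alpha>) \<longlongrightarrow> ?L) (at_right 0)"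
    using tendsto_cong by force
qed

text \<open>Convexity bounds every difference quotient by the full increment; the bound survives the
  limit.\<close>

lemma convex_sensitivity_le:
  assumes conv: "convex_on_Xi \<Psi>" and proper: "proper_on_Xi \<Psi>" and sens: "sensitivity_function \<Psi> \<psi>"
    and \<xi>: "\<xi> \<in> dom \<Psi>" and \<eta>: "\<eta> \<in> dom \<Psi>"
  shows "(\<integral>x. \<psi> \<xi> x \<partial>\<eta>) \<le> real_of_ereal (\<Psi> \<eta>) - real_of_ereal (\<Psi> \<xi>)"
proof -
  obtain a b where ab: "\<Psi> \<xi> = ereal a" "\<Psi> \<eta> = ereal b"
    using dom_ereal[OF proper] \<xi> \<eta> by blast
  have X: "\<xi> \<in> Xi UNIV" "\<eta> \<in> Xi UNIV" using \<xi> \<eta> by (auto simp: dom_def)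
  note s = sensitivity_function_real[OF proper sens \<xi> X(2)]
  show ?thesis
  proof (rule tendsto_upperbound[OF s(2)])
    show "eventually (\<lambda>\<alpha>. (real_of_ereal (\<Psi> (mix \<xi> \<eta> \<alpha>)) - real_of_ereal (\<Psi> \<xi>)) / \<alpha>
      \<le> real_of_ereal (\<Psi> \<eta>) - real_of_ereal (\<Psi> \<xi>)) (at_right 0)"
      using eventually_at_right_0_unit s(1)
    proof eventually_elim
      case (elim \<alpha>)
      then obtain c where c: "\<Psi> (mix \<xi> \<eta> \<alpha>) = ereal c" using dom_ereal[OF proper] by blast
      have "\<Psi> (mix \<xi> \<eta> \<alpha>) \<le> ereal (1 - \<alpha>) * \<Psi> \<xi> + ereal \<alpha> * \<Psi> \<eta>"
        using conv X elim unfolding convex_on_Xi_def by auto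
      then have "c \<le> (1 - \<alpha>) * a + \<alpha> * b" using ab c by simp
      then have "c - a \<le> (b - a) * \<alpha>" by (simp add: algebra_simps)
      then show ?case using elim ab c by (simp add: pos_divide_le_eq)
    qed
  qed simp
qed

lemma affine_imp_convex_on_Xi: "affine_on_Xi \<Psi> \<Longrightarrow> convex_on_Xi \<Psi>"
  unfolding affine_on_Xi_def convex_on_Xi_def by simp

lemma real_valued_imp_proper_on_Xi: "real_valued_on_Xi \<Psi> \<Longrightarrow> proper_on_Xi \<Psi>"
  unfolding real_valued_on_Xi_def proper_on_Xi_def by force

lemma dom_real_valued_on_Xi: "real_valued_on_Xi \<Psi> \<Longrightarrow> dom \<Psi> = Xi UNIV"
  unfolding real_valued_on_Xi_def dom_def by force

text \<open>The difference quotients are constant, and the integral representation identifies the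
  constant with the integral of \<psi>. This lets equality constraints be treated like the other
  convex functions.\<close>

lemma affine_sensitivity_function:
  fixes \<Psi> :: "'a::metric_space measure \<Rightarrow> ereal"
  assumes comp: "compact (UNIV :: 'a set)"
    and aff: "affine_on_Xi \<Psi>" and rv: "real_valued_on_Xi \<Psi>"
    and cont: "continuous_map weak_topology euclideanreal (\<lambda>\<xi>. real_of_ereal (\<Psi> \<xi>))"
    and \<psi>: "\<And>\<xi> x. \<xi> \<in> Xi UNIV \<Longrightarrow> \<psi> \<xi> x = real_of_ereal (\<Psi> (return borel x)) - real_of_ereal (\<Psi> \<xi>)"
  shows "sensitivity_function \<Psi> \<psi>"
  unfolding sensitivity_function_def dom_real_valued_on_Xi[OF rv]
proof (intro ballI conjI)
  fix \<xi> \<eta> :: "'a measure" assume \<xi>: "\<xi> \<in> Xi UNIV" and \<eta>: "\<eta> \<in> Xi UNIV"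
  interpret prob_space \<eta> by (rule XiD[OF \<eta>])
  note rep = affine_integral_representation[OF comp aff rv cont \<eta>]
  have \<psi>_eq: "\<psi> \<xi> = (\<lambda>x. real_of_ereal (\<Psi> (return borel x)) - real_of_ereal (\<Psi> \<xi>))"
    using \<psi>[OF \<xi>] by auto
  show "integrable \<eta> (\<psi> \<xi>)" unfolding \<psi>_eq using rep(1) by simp
  have int: "(\<integral>x. \<psi> \<xi> x \<partial>\<eta>) = real_of_ereal (\<Psi> \<eta>) - real_of_ereal (\<Psi> \<xi>)"
    unfolding \<psi>_eq using rep by (simp add: prob_space)
  obtain a b where ab: "\<Psi> \<xi> = ereal a" "\<Psi> \<eta> = ereal b"
    using dom_ereal[OF real_valued_imp_proper_on_Xi[OF rv]] \<xi> \<eta> dom_real_valued_on_Xi[OF rv] by blast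
  have "eventually (\<lambda>\<alpha>. (\<Psi> (mix \<xi> \<eta> \<alpha>) - \<Psi> \<xi>) / ereal \<alpha> = ereal (b - a)) (at_right 0)"
    using eventually_at_right_0_unit
  proof eventually_elim
    case (elim \<alpha>)
    have "\<Psi> (mix \<xi> \<eta> \<alpha>) = ereal (1 - \<alpha>) * \<Psi> \<xi> + ereal \<alpha> * \<Psi> \<eta>"
      using aff \<xi> \<eta> elim unfolding affine_on_Xi_def by auto
    then show ?case using ab elim by (simp add: field_simps)
  qed
  then show "((\<lambda>\<alpha>. (\<Psi> (mix \<xi> \<eta> \<alpha>) - \<Psi> \<xi>) / ereal \<alpha>) \<longlongrightarrow> ereal (\<integral>x. \<psi> \<xi> x \<partial>\<eta>)) (at_right 0)"
    unfolding int using ab by (intro tendsto_eventually) simp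
qed

section \<open>Saddle points\<close>

text \<open>Equality constraints enter here only as convex functions with a sensitivity function;
  affinity is passed separately to the lemmas where the sign of a multiplier is free.\<close>

locale convex_program =
  fixes \<Psi> :: "'i::zero \<Rightarrow> 'a::metric_space measure \<Rightarrow> ereal"
    and \<psi> :: "'i \<Rightarrow> 'a measure \<Rightarrow> 'a \<Rightarrow> real"
    and Iineq Ieq :: "'i set"
  assumes finite_ineq: "finite Iineq" and finite_eq: "finite Ieq" and disjoint: "Iineq \<inter> Ieq = {}"
    and proper: "\<And>i. i \<in> insert 0 (Iineq \<union> Ieq) \<Longrightarrow> proper_on_Xi (\<Psi> i)"
    and convex: "\<And>i. i \<in> insert 0 (Iineq \<union> Ieq) \<Longrightarrow> convex_on_Xi (\<Psi> i)"
    and sensitivity: "\<And>i. i \<in> insert 0 (Iineq \<union> Ieq) \<Longrightarrow> sensitivity_function (\<Psi> i) (\<psi> i)"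
begin

abbreviation "I \<equiv> Iineq \<union> Ieq"
abbreviation "V i \<xi> \<equiv> real_of_ereal (\<Psi> i \<xi>)"
abbreviation "Fin \<equiv> Xi_fin \<Psi> Iineq Ieq"
abbreviation "Feas \<equiv> Xi_feas \<Psi> Iineq Ieq"
abbreviation "L \<equiv> Lagrangian \<Psi> Iineq Ieq"
abbreviation "pL \<equiv> psiL \<psi> Iineq Ieq"
abbreviation "saddle \<equiv> saddle_point \<Psi> Iineq Ieq"

lemma finite_I: "finite I" using finite_ineq finite_eq by simp

lemma Xi_fin_iff: "\<xi> \<in> Fin S \<longleftrightarrow> \<xi> \<in> Xi S \<and> (\<forall>i\<in>insert 0 I. \<xi> \<in> dom (\<Psi> i))"
  unfolding Xi_fin_def by auto

lemma Xi_fin_mono: "S \<subseteq> T \<Longrightarrow> S \<in> sets borel \<Longrightarrow> Fin S \<subseteq> Fin T"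
  using Xi_mono[of S T] unfolding Xi_fin_def by auto

lemma Psi_eq_V: "\<xi> \<in> Fin S \<Longrightarrow> i \<in> insert 0 I \<Longrightarrow> \<Psi> i \<xi> = ereal (V i \<xi>)"
  by (rule dom_ereal[OF proper]) (auto simp: Xi_fin_iff)

text \<open>Differentiability in all directions keeps small mixtures in each of the finitely many
  domains, even if \<eta> itself lies outside. So Dirac measures are admissible directions.\<close>

lemma mix_in_Xi_fin:
  assumes "\<xi> \<in> Fin S" "\<eta> \<in> Xi S" "S \<in> sets borel"
  shows "eventually (\<lambda>\<alpha>. mix \<xi> \<eta> \<alpha> \<in> Fin S) (at_right 0)"
proof -
  have \<eta>: "\<eta> \<in> Xi UNIV" using assms(2) Xi_subset_UNIV by auto
  have "eventually (\<lambda>\<alpha>. \<forall>i\<in>insert 0 I. mix \<xi> \<eta> \<alpha> \<in> dom (\<Psi> i)) (at_right 0)"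
    using finite_I assms(1) \<eta>
    by (intro eventually_ball_finite ballI sensitivity_function_real(1)[OF proper sensitivity]) (auto simp: Xi_fin_iff)
  with eventually_at_right_0_unit show ?thesis
    by eventually_elim (use assms in \<open>auto simp: Xi_fin_iff intro!: mix_in_Xi\<close>)
qed

lemma psiL_integrable:
  assumes "\<xi> \<in> Fin S" "\<eta> \<in> Xi UNIV"
  shows "integrable \<eta> (pL \<xi> l)"
    and "(\<integral>x. pL \<xi> l x \<partial>\<eta>) = (\<integral>x. \<psi> 0 \<xi> x \<partial>\<eta>) + (\<Sum>i\<in>I. l i * (\<integral>x. \<psi> i \<xi> x \<partial>\<eta>))"
proof -
  have i: "integrable \<eta> (\<psi> i \<xi>)" if "i \<in> insert 0 I" for i
    using sensitivity[OF that] assms that unfolding sensitivity_function_def by (auto simp: Xi_fin_iff)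
  have pL: "pL \<xi> l = (\<lambda>x. \<psi> 0 \<xi> x + (\<Sum>i\<in>I. l i * \<psi> i \<xi> x))"
    by (auto simp: psiL_def)
  show "integrable \<eta> (pL \<xi> l)"
    unfolding pL using i by (intro Bochner_Integration.integrable_add Bochner_Integration.integrable_sum
      integrable_mult_right) auto
  show "(\<integral>x. pL \<xi> l x \<partial>\<eta>) = (\<integral>x. \<psi> 0 \<xi> x \<partial>\<eta>) + (\<Sum>i\<in>I. l i * (\<integral>x. \<psi> i \<xi> x \<partial>\<eta>))"
    unfolding pL using i
    by (subst Bochner_Integration.integral_add) (auto simp: Bochner_Integration.integral_sum)
qed

section \<open>Variation of the Lagrangian in the measure\<close>

lemma Lagrangian_directional_derivative:
  assumes "\<xi> \<in> Fin S" "\<eta> \<in> Xi UNIV"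
  shows "((\<lambda>\<alpha>. (L (mix \<xi> \<eta> \<alpha>) l - L \<xi> l) / \<alpha>) \<longlongrightarrow> (\<integral>x. pL \<xi> l x \<partial>\<eta>)) (at_right 0)"
proof -
  have s: "((\<lambda>\<alpha>. (V i (mix \<xi> \<eta> \<alpha>) - V i \<xi>) / \<alpha>) \<longlongrightarrow> (\<integral>x. \<psi> i \<xi> x \<partial>\<eta>)) (at_right 0)"
    if "i \<in> insert 0 I" for i
    using sensitivity_function_real(2)[OF proper[OF that] sensitivity[OF that] _ assms(2)] assms(1) that
    by (auto simp: Xi_fin_iff)
  have "((\<lambda>\<alpha>. (V 0 (mix \<xi> \<eta> \<alpha>) - V 0 \<xi>) / \<alpha> + (\<Sum>i\<in>I. l i * ((V i (mix \<xi> \<eta> \<alpha>) - V i \<xi>) / \<alpha>))) \<longlongrightarrow>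
    (\<integral>x. pL \<xi> l x \<partial>\<eta>)) (at_right 0)"
    unfolding psiL_integrable(2)[OF assms] using s by (intro tendsto_intros) auto
  moreover have "(L (mix \<xi> \<eta> \<alpha>) l - L \<xi> l) / \<alpha> =
    (V 0 (mix \<xi> \<eta> \<alpha>) - V 0 \<xi>) / \<alpha> + (\<Sum>i\<in>I. l i * ((V i (mix \<xi> \<eta> \<alpha>) - V i \<xi>) / \<alpha>))" for \<alpha>
    by (simp add: Lagrangian_def add_divide_distrib diff_divide_distrib sum_divide_distrib
      right_diff_distrib sum_subtractf)
  ultimately show ?thesis by simp
qed

text \<open>The gradient inequalities of the constraints may be multiplied by nonnegative
  multipliers; for indices in \<open>Ieq\<close>, where the sign is free, the assumed equality
  replaces them.\<close>

lemma Lagrangian_gradient_inequality: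
  assumes \<xi>: "\<xi> \<in> Fin UNIV" and \<eta>: "\<eta> \<in> Fin UNIV" and l: "l \<in> multipliers Iineq"
    and affine: "\<And>i. i \<in> Ieq \<Longrightarrow> (\<integral>x. \<psi> i \<xi> x \<partial>\<eta>) = V i \<eta> - V i \<xi>"
  shows "(\<integral>x. pL \<xi> l x \<partial>\<eta>) \<le> L \<eta> l - L \<xi> l"
proof -
  have \<eta>X: "\<eta> \<in> Xi UNIV" using \<eta> by (simp add: Xi_fin_iff)
  have le: "(\<integral>x. \<psi> i \<xi> x \<partial>\<eta>) \<le> V i \<eta> - V i \<xi>" if "i \<in> insert 0 I" for i
    using convex_sensitivity_le[OF convex[OF that] proper[OF that] sensitivity[OF that]] \<xi> \<eta> that
    by (auto simp: Xi_fin_iff)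
  have "l i * (\<integral>x. \<psi> i \<xi> x \<partial>\<eta>) \<le> l i * (V i \<eta> - V i \<xi>)" if "i \<in> I" for i
    using that le[of i] l affine[of i] by (cases "i \<in> Ieq") (auto simp: multipliers_def intro: mult_left_mono)
  then have "(\<integral>x. pL \<xi> l x \<partial>\<eta>) \<le> (V 0 \<eta> - V 0 \<xi>) + (\<Sum>i\<in>I. l i * (V i \<eta> - V i \<xi>))"
    unfolding psiL_integrable(2)[OF \<xi> \<eta>X] using le[of 0] by (intro add_mono sum_mono) auto
  then show ?thesis by (simp add: Lagrangian_def right_diff_distrib sum_subtractf)
qed

section \<open>Consequences of the saddle point property\<close>

lemma Lagrangian_fun_upd:
  assumes "i \<in> I"
  shows "L \<xi> (l(i := t)) = L \<xi> l + (t - l i) * V i \<xi>"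
proof -
  have "(\<Sum>j\<in>I. (l(i := t)) j * V j \<xi>) = (\<Sum>j\<in>I. l j * V j \<xi> + (if j = i then (t - l i) * V i \<xi> else 0))"
    by (intro sum.cong) (auto simp: algebra_simps)
  also have "\<dots> = (\<Sum>j\<in>I. l j * V j \<xi>) + (t - l i) * V i \<xi>"
    using finite_I assms by (simp add: sum.distrib)
  finally show ?thesis by (simp add: Lagrangian_def)
qed

lemma saddle_pointD:
  assumes sp: "saddle S \<xi> l"
  shows "\<xi> \<in> Fin S" "l \<in> multipliers Iineq" "\<And>\<eta>. \<eta> \<in> Fin S \<Longrightarrow> L \<xi> l \<le> L \<eta> l"
    "\<And>m. m \<in> multipliers Iineq \<Longrightarrow> L \<xi> m \<le> L \<xi> l"
  using sp unfolding saddle_point_def by blast+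

text \<open>Only one multiplier is changed at a time. Raising it by 1 gives the upper bound,
  lowering it by 1 is allowed for equalities and gives the reverse bound, and setting it to 0 gives
  complementary slackness.\<close>

lemma saddle_point_V:
  assumes sp: "saddle S \<xi> l"
  shows "i \<in> Iineq \<Longrightarrow> V i \<xi> \<le> 0" "i \<in> Ieq \<Longrightarrow> V i \<xi> = 0" "i \<in> I \<Longrightarrow> l i * V i \<xi> = 0"
proof -
  note s = saddle_pointD[OF sp]
  have step: "(t - l i) * V i \<xi> \<le> 0" if "i \<in> I" "i \<in> Iineq \<Longrightarrow> 0 \<le> t" for i t
  proof -
    have "l(i := t) \<in> multipliers Iineq" using s(2) that by (auto simp: multipliers_def)
    then show ?thesis using s(4)[of "l(i := t)"] Lagrangian_fun_upd[OF that(1)] by simp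
  qed
  have pos: "0 \<le> l i" if "i \<in> Iineq" for i using s(2) that by (auto simp: multipliers_def)
  have le: "V i \<xi> \<le> 0" if "i \<in> I" for i
    using step[OF that, of "l i + 1"] pos[of i] by auto
  then show "i \<in> Iineq \<Longrightarrow> V i \<xi> \<le> 0" by auto
  show eq: "V i \<xi> = 0" if "i \<in> Ieq" for i
  proof -
    have "i \<in> I" "i \<notin> Iineq" using that disjoint by auto
    then show ?thesis using step[of i "l i - 1"] le[of i] by (intro antisym) auto
  qed
  show "l i * V i \<xi> = 0" if "i \<in> I" for i
  proof (cases "i \<in> Ieq")
    case False
    then have i: "i \<in> Iineq" using that by auto
    have "l i * V i \<xi> \<le> 0" by (rule mult_nonneg_nonpos[OF pos[OF i] le[OF that]])
    moreover have "- (l i * V i \<xi>) \<le> 0" using step[OF that, of 0] by simp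
    ultimately show ?thesis by linarith
  qed (simp add: eq)
qed

lemma saddle_point_Lagrangian: "saddle S \<xi> l \<Longrightarrow> L \<xi> l = V 0 \<xi>"
  using saddle_point_V(3)[of S \<xi> l] by (simp add: Lagrangian_def sum.neutral del: mult_eq_0_iff)

lemma saddle_point_feasible:
  assumes sp: "saddle S \<xi> l"
  shows "\<xi> \<in> Feas S"
proof -
  note F = saddle_pointD(1)[OF sp]
  have "\<Psi> i \<xi> \<le> 0" if "i \<in> Iineq" for i
    using Psi_eq_V[OF F, of i] saddle_point_V(1)[OF sp that] that
    by (metis UnI1 ereal_less_eq(3) insertI2 zero_ereal_def)
  moreover have "\<Psi> i \<xi> = 0" if "i \<in> Ieq" for i
    using Psi_eq_V[OF F, of i] saddle_point_V(2)[OF sp that] that by (metis UnCI insertCI zero_ereal_def)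
  ultimately show ?thesis using F by (auto simp: Xi_feas_def Xi_fin_iff)
qed

text \<open>A small step from the minimizer \<xi> of the Lagrangian towards the Dirac measure at
  \<open>x\<close> stays in \<open>Fin S\<close>, so the directional derivative is nonnegative; it
  equals \<open>pL \<xi> l x\<close>.\<close>

lemma saddle_point_psiL_nonneg:
  assumes sp: "saddle S \<xi> l" and S: "S \<in> sets borel" "x \<in> S"
  shows "0 \<le> pL \<xi> l x"
proof -
  note s = saddle_pointD[OF sp]
  have \<eta>: "return borel x \<in> Xi S" "return borel x \<in> Xi UNIV"
    using S by (auto intro: return_in_Xi)
  have "0 \<le> (\<integral>x. pL \<xi> l x \<partial>return borel x)"
  proof (rule tendsto_lowerbound[OF Lagrangian_directional_derivative[OF s(1) \<eta>(2)]])
    show "eventually (\<lambda>\<alpha>. 0 \<le> (L (mix \<xi> (return borel x) \<alpha>) l - L \<xi> l) / \<alpha>) (at_right 0)"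
      using mix_in_Xi_fin[OF s(1) \<eta>(1) S(1)] eventually_at_right_0_unit
      by eventually_elim (use s(3) in \<open>auto intro!: divide_nonneg_pos\<close>)
  qed simp
  moreover have "(\<integral>x. pL \<xi> l x \<partial>return borel x) = pL \<xi> l x"
    using borel_measurable_integrable[OF psiL_integrable(1)[OF s(1) \<eta>(2), of l]]
    by (intro integral_return) simp_all
  ultimately show ?thesis by simp
qed

text \<open>For a feasible \<eta> of finite objective value the Lagrangian is at most that value,
  while at \<xi> it equals the objective. The gradient inequality bounds the gap by integrating the
  pointwise bound.\<close>

lemma eps_optimal_if_psiL_ge:
  assumes sp: "saddle S \<xi> l" and ge: "\<And>x. - \<epsilon> \<le> pL \<xi> l x"
    and affine: "\<And>i \<eta>. i \<in> Ieq \<Longrightarrow> \<eta> \<in> Xi UNIV \<Longrightarrow> (\<integral>x. \<psi> i \<xi> x \<partial>\<eta>) = V i \<eta> - V i \<xi>"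
  shows "eps_optimal \<Psi> Iineq Ieq \<epsilon> \<xi>"
proof -
  note s = saddle_pointD[OF sp]
  have \<xi>: "\<xi> \<in> Fin UNIV" using s(1) Xi_subset_UNIV by (auto simp: Xi_fin_iff)
  have feas: "\<xi> \<in> Feas UNIV"
    using saddle_point_feasible[OF sp] Xi_subset_UNIV by (auto simp: Xi_feas_def)
  have "\<Psi> 0 \<xi> - ereal \<epsilon> \<le> \<Psi> 0 \<eta>" if \<eta>: "\<eta> \<in> Feas UNIV" for \<eta>
  proof (cases "\<Psi> 0 \<eta> = \<infinity>")
    case False
    have \<eta>X: "\<eta> \<in> Xi UNIV" using \<eta> by (simp add: Xi_feas_def)
    interpret prob_space \<eta> by (rule XiD[OF \<eta>X])
    have "\<Psi> i \<eta> < \<infinity>" if "i \<in> I" for i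
      using \<eta> that by (auto simp: Xi_feas_def intro: le_less_trans[of _ 0])
    then have \<eta>F: "\<eta> \<in> Fin UNIV"
      using False \<eta>X by (auto simp: Xi_fin_def dom_def less_top[symmetric])
    have V: "i \<in> Iineq \<Longrightarrow> V i \<eta> \<le> 0" "i \<in> Ieq \<Longrightarrow> V i \<eta> = 0" for i
      using \<eta> Psi_eq_V[OF \<eta>F, of i] by (auto simp: Xi_feas_def real_of_ereal_le_0)
    have "l i * V i \<eta> \<le> 0" if "i \<in> I" for i
      using that V[of i] s(2) by (auto simp: multipliers_def intro: mult_nonneg_nonpos)
    then have "L \<eta> l \<le> V 0 \<eta>" unfolding Lagrangian_def by (auto intro!: sum_nonpos)
    have "- \<epsilon> = (\<integral>x. - \<epsilon> \<partial>\<eta>)" by (simp add: prob_space)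
    also have "\<dots> \<le> (\<integral>x. pL \<xi> l x \<partial>\<eta>)"
      using ge by (intro integral_mono psiL_integrable(1)[OF \<xi> \<eta>X]) auto
    also have "\<dots> \<le> L \<eta> l - L \<xi> l"
      by (rule Lagrangian_gradient_inequality[OF \<xi> \<eta>F s(2) affine[OF _ \<eta>X]])
    also have "\<dots> \<le> V 0 \<eta> - V 0 \<xi>"
      using \<open>L \<eta> l \<le> V 0 \<eta>\<close> saddle_point_Lagrangian[OF sp] by simp
    finally have "ereal (V 0 \<xi>) - ereal \<epsilon> \<le> ereal (V 0 \<eta>)" by simp
    then show ?thesis using Psi_eq_V[OF \<xi>, of 0] Psi_eq_V[OF \<eta>F, of 0] by simp
  qed simp
  then have "\<Psi> 0 \<xi> - ereal \<epsilon> \<le> (INF \<eta>\<in>Feas UNIV. \<Psi> 0 \<eta>)" by (rule INF_greatest)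
  then have "\<Psi> 0 \<xi> \<le> (INF \<eta>\<in>Feas UNIV. \<Psi> 0 \<eta>) + ereal \<epsilon>"
    by (simp add: ereal_minus_le_iff add.commute)
  with feas show ?thesis by (simp add: eps_optimal_def)
qed

end

section \<open>Lower semicontinuity\<close>

text \<open>Otherwise the open superlevel set at \<open>c\<close> would be a neighbourhood of the
  limit and eventually contain \<open>\<mu> n\<close>.\<close>

lemma lower_semicontinuous_limit_le:
  assumes "lower_semicontinuous \<Psi>" "limitin weak_topology \<mu> \<nu> F" "F \<noteq> bot"
    and "eventually (\<lambda>n. \<Psi> (\<mu> n) \<le> c) F"
  shows "\<Psi> \<nu> \<le> c"
proof (rule ccontr)
  assume "\<not> \<Psi> \<nu> \<le> c"
  then have "\<nu> \<in> {\<xi> \<in> Xi UNIV. c < \<Psi> \<xi>}" using limitin_topspace[OF assms(2)] by simp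
  with assms(1,2) have "eventually (\<lambda>n. \<mu> n \<in> {\<xi> \<in> Xi UNIV. c < \<Psi> \<xi>}) F"
    unfolding lower_semicontinuous_def limitin_def by blast
  with assms(4) have "eventually (\<lambda>n. False) F" by eventually_elim auto
  with assms(3) show False by simp
qed

text \<open>Along measures with values below \<open>- n\<close>, a weak cluster point would have
  value \<open>-\<infinity>\<close>, which properness excludes.\<close>

lemma lower_semicontinuous_bounded_below:
  fixes \<Psi> :: "'a::metric_space measure \<Rightarrow> ereal"
  assumes comp: "compact (UNIV :: 'a set)" and lsc: "lower_semicontinuous \<Psi>" and proper: "proper_on_Xi \<Psi>"
  obtains b :: real where "\<And>\<xi>. \<xi> \<in> Xi UNIV \<Longrightarrow> ereal b \<le> \<Psi> \<xi>"
proof (rule ccontr)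
  assume no_bound: "\<not> thesis"
  have "\<exists>\<xi>. \<xi> \<in> Xi UNIV \<and> \<Psi> \<xi> < ereal (- real n)" for n
  proof (rule ccontr)
    assume "\<nexists>\<xi>. \<xi> \<in> Xi UNIV \<and> \<Psi> \<xi> < ereal (- real n)"
    then have "ereal (- real n) \<le> \<Psi> \<xi>" if "\<xi> \<in> Xi UNIV" for \<xi>
      using that not_le by blast
    with no_bound that show False by blast
  qed
  then obtain \<mu> where \<mu>: "\<And>n. \<mu> n \<in> Xi UNIV" "\<And>n. \<Psi> (\<mu> n) < ereal (- real n)" by metis
  obtain r \<nu> where r: "strict_mono (r :: nat \<Rightarrow> nat)" and lim: "limitin weak_topology (\<mu> \<circ> r) \<nu> sequentially"
    by (rule sequentially_compact_Xi[of \<mu>, OF comp \<mu>(1)])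
  have "\<Psi> \<nu> \<le> ereal (- real k)" for k
  proof (rule lower_semicontinuous_limit_le[OF lsc lim])
    show "eventually (\<lambda>n. \<Psi> ((\<mu> \<circ> r) n) \<le> ereal (- real k)) sequentially"
      using eventually_ge_at_top[of k]
    proof eventually_elim
      case (elim n)
      then have "k \<le> r n" using seq_suble[OF r, of n] by simp
      then have "ereal (- real (r n)) \<le> ereal (- real k)" by simp
      with \<mu>(2)[of "r n"] show ?case unfolding comp_apply by (rule less_imp_le[OF less_le_trans])
    qed
  qed simp
  moreover have "\<Psi> \<nu> \<noteq> - \<infinity>" using proper limitin_topspace[OF lim] by (auto simp: proper_on_Xi_def)
  ultimately show False
  proof (cases "\<Psi> \<nu>")
    case (real a)
    obtain k :: nat where "- a < real k" using reals_Archimedean2 by blast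
    with \<open>\<And>k. \<Psi> \<nu> \<le> ereal (- real k)\<close>[of k] real show False by simp
  next
    case PInf
    with \<open>\<And>k. \<Psi> \<nu> \<le> ereal (- real k)\<close>[of 0] show False by simp
  qed simp
qed

section \<open>Convergence\<close>

text \<open>Bolzano-Weierstrass is applied to one index after the other; convergence already
  obtained survives further extraction.\<close>

lemma common_convergent_subsequence:
  fixes f :: "'i \<Rightarrow> nat \<Rightarrow> 'b::heine_borel"
  assumes "finite J" "\<And>i. i \<in> J \<Longrightarrow> bounded (range (f i))"
  obtains r where "strict_mono (r :: nat \<Rightarrow> nat)" "\<And>i. i \<in> J \<Longrightarrow> convergent (\<lambda>n. f i (r n))"
proof -
  have "\<exists>r. strict_mono (r :: nat \<Rightarrow> nat) \<and> (\<forall>i\<in>J. convergent (\<lambda>n. f i (r n)))"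
    using assms
  proof (induction J rule: finite_induct)
    case empty
    show ?case using strict_mono_id by blast
  next
    case (insert i J)
    then obtain r where r: "strict_mono (r :: nat \<Rightarrow> nat)" "\<forall>i\<in>J. convergent (\<lambda>n. f i (r n))" by auto
    have "bounded (range (f i \<circ> r))"
      by (rule bounded_subset[OF insert.prems[of i]]) auto
    then obtain s l where s: "strict_mono (s :: nat \<Rightarrow> nat)" "((f i \<circ> r) \<circ> s) \<longlonglongrightarrow> l"
      using bounded_imp_convergent_subsequence by blast
    have "convergent (\<lambda>n. f j (r (s n)))" if "j \<in> insert i J" for j
    proof (cases "j = i")
      case True
      then show ?thesis using s(2) by (auto simp: convergent_def comp_def)
    next
      case False
      then have "convergent (\<lambda>n. f j (r n))" using that r(2) by auto
      then show ?thesis using convergent_subseq_convergent[OF _ s(1)] by (fastforce simp: comp_def)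
    qed
    then show ?case using strict_mono_o[OF r(1) s(1)] by (intro exI[of _ "r \<circ> s"]) (auto simp: comp_def)
  qed
  with that show thesis by blast
qed

context convex_program
begin

section \<open>Boundedness of the multipliers\<close>

text \<open>The inequality \<open>m \<le> L \<eta> (l k)\<close> on \<open>Fin X0\<close> is divided
  by the sum \<open>t k\<close> of the absolute multipliers. If \<open>t\<close> were unbounded, a
  limit \<open>a\<close> of norm 1 would satisfy
  \<open>0 \<le> (\<Sum>i\<in>I. a i * V i \<eta>)\<close> for all these \<eta>.\<close>

lemma bounded_multipliers:
  assumes aff: "\<And>i. i \<in> Ieq \<Longrightarrow> affine_on_Xi (\<Psi> i)" and rv: "\<And>i. i \<in> Ieq \<Longrightarrow> real_valued_on_Xi (\<Psi> i)"
    and \<eta>0: "\<eta>0 \<in> Fin X0" "\<And>i. i \<in> Iineq \<Longrightarrow> V i \<eta>0 < 0" "\<And>i. i \<in> Ieq \<Longrightarrow> V i \<eta>0 = 0"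
    and not_one_sided: "\<not> one_sided Ieq ((\<lambda>\<xi> i. V i \<xi>) ` Xi X0)"
    and X0: "X0 \<in> sets borel" "\<And>k. X0 \<subseteq> S k"
    and sp: "\<And>k. saddle (S k) (\<xi> k) (l k)" and m: "\<And>k. m \<le> V 0 (\<xi> k)"
  obtains B where "\<And>i k. i \<in> I \<Longrightarrow> \<bar>l k i\<bar> \<le> B"
proof -
  define t where "t k = (\<Sum>i\<in>I. \<bar>l k i\<bar>)" for k
  have lt: "\<bar>l k i\<bar> \<le> t k" if "i \<in> I" for i k
    unfolding t_def using that finite_I by (intro member_le_sum) auto
  have "\<exists>B. \<forall>k. t k \<le> B"
  proof (rule ccontr)
    assume "\<nexists>B. \<forall>k. t k \<le> B"
    then have "\<forall>n. \<exists>k. t k > real (Suc n)" by (meson not_le)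
    \<comment> \<open>The bound \<open>Suc n\<close> makes the normalizing sums positive from
      \<open>n = 0\<close> on; \<kappa> itself may fail to be monotone.\<close>
    then obtain \<kappa> where \<kappa>: "\<And>n. t (\<kappa> n) > real (Suc n)" by metis
    have t_pos: "t (\<kappa> n) > 0" for n using \<kappa>[of n] by simp
    define \<nu> where "\<nu> i n = l (\<kappa> n) i / t (\<kappa> n)" for i n
    have "\<bar>\<nu> i n\<bar> \<le> 1" if "i \<in> I" for i n
      using lt[OF that, of "\<kappa> n"] t_pos[of n] by (simp add: \<nu>_def abs_divide)
    then have bd: "bounded (range (\<nu> i))" if "i \<in> I" for i
      unfolding bounded_iff using that by (intro exI[of _ 1]) auto
    obtain r where r: "strict_mono (r :: nat \<Rightarrow> nat)" and conv: "\<And>i. i \<in> I \<Longrightarrow> convergent (\<lambda>n. \<nu> i (r n))"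
      by (rule common_convergent_subsequence[of I \<nu>, OF finite_I bd]) blast+
    have "\<forall>i\<in>I. \<exists>a. (\<lambda>n. \<nu> i (r n)) \<longlonglongrightarrow> a" using conv by (auto simp: convergent_def)
    then obtain a where a: "\<And>i. i \<in> I \<Longrightarrow> (\<lambda>n. \<nu> i (r n)) \<longlonglongrightarrow> a i" by metis
    have "(\<Sum>i\<in>I. \<bar>\<nu> i n\<bar>) = 1" for n
      using t_pos[of n] unfolding \<nu>_def by (simp add: abs_divide sum_divide_distrib[symmetric] t_def[symmetric])
    moreover have "(\<lambda>n. \<Sum>i\<in>I. \<bar>\<nu> i (r n)\<bar>) \<longlonglongrightarrow> (\<Sum>i\<in>I. \<bar>a i\<bar>)"
      using a by (intro tendsto_intros) auto
    ultimately have a1: "(\<Sum>i\<in>I. \<bar>a i\<bar>) = 1" by (simp add: LIMSEQ_const_iff)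
    have "0 \<le> \<nu> i n" if "i \<in> Iineq" for i n
      using saddle_pointD(2)[OF sp[of "\<kappa> n"]] that t_pos[of n] by (auto simp: \<nu>_def multipliers_def)
    then have a_nonneg: "0 \<le> a i" if "i \<in> Iineq" for i
      using that by (intro LIMSEQ_le_const[OF a]) auto
    have "real n \<le> t (\<kappa> n)" for n using \<kappa>[of n] by simp
    then have "filterlim (\<lambda>n. t (\<kappa> n)) at_top sequentially"
      by (intro filterlim_at_top_mono[OF filterlim_real_sequentially] always_eventually allI)
    then have t_lim: "filterlim (\<lambda>n. t (\<kappa> (r n))) at_top sequentially"
      by (rule filterlim_compose) (rule filterlim_subseq[OF r])
    have nonneg: "0 \<le> (\<Sum>i\<in>I. a i * V i \<eta>)" if \<eta>: "\<eta> \<in> Fin X0" for \<eta>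
    proof (rule LIMSEQ_le)
      show "(\<lambda>n. (m - V 0 \<eta>) / t (\<kappa> (r n))) \<longlonglongrightarrow> 0"
        by (rule real_tendsto_divide_at_top[OF tendsto_const t_lim])
      show "(\<lambda>n. \<Sum>i\<in>I. \<nu> i (r n) * V i \<eta>) \<longlonglongrightarrow> (\<Sum>i\<in>I. a i * V i \<eta>)"
        using a by (intro tendsto_intros) auto
      have "(m - V 0 \<eta>) / t (\<kappa> n) \<le> (\<Sum>i\<in>I. \<nu> i n * V i \<eta>)" for n
      proof -
        have "\<eta> \<in> Fin (S (\<kappa> n))" using \<eta> Xi_fin_mono[OF X0(2,1)] by auto
        then have "V 0 (\<xi> (\<kappa> n)) \<le> L \<eta> (l (\<kappa> n))"
          using saddle_pointD(3)[OF sp[of "\<kappa> n"]] saddle_point_Lagrangian[OF sp[of "\<kappa> n"]] by simp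
        then have "m - V 0 \<eta> \<le> (\<Sum>i\<in>I. l (\<kappa> n) i * V i \<eta>)"
          using m[of "\<kappa> n"] by (simp add: Lagrangian_def)
        then have "(m - V 0 \<eta>) / t (\<kappa> n) \<le> (\<Sum>i\<in>I. l (\<kappa> n) i * V i \<eta>) / t (\<kappa> n)"
          using t_pos[of n] by (intro divide_right_mono) auto
        then show ?thesis by (simp add: \<nu>_def sum_divide_distrib)
      qed
      then show "\<exists>N. \<forall>n\<ge>N. (m - V 0 \<eta>) / t (\<kappa> (r n)) \<le> (\<Sum>i\<in>I. \<nu> i (r n) * V i \<eta>)" by auto
    qed
    have split: "(\<Sum>i\<in>I. f i) = (\<Sum>i\<in>Iineq. f i) + (\<Sum>i\<in>Ieq. f i)" for f :: "'i \<Rightarrow> real"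
      by (rule sum.union_disjoint[OF finite_ineq finite_eq disjoint])
    \<comment> \<open>At the Slater point all terms are nonpositive but their sum is nonnegative, so
      each vanishes, and \<open>V i \<eta>0 < 0\<close> forces \<open>a i = 0\<close>.\<close>
    have a0: "a i = 0" if i: "i \<in> Iineq" for i
    proof -
      have le: "a j * V j \<eta>0 \<le> 0" if "j \<in> Iineq" for j
        using a_nonneg[OF that] less_imp_le[OF \<eta>0(2)[OF that]] by (rule mult_nonneg_nonpos)
      have "0 \<le> (\<Sum>i\<in>Iineq. a i * V i \<eta>0)"
        using nonneg[OF \<eta>0(1)] \<eta>0(3) unfolding split by simp
      then have "(\<Sum>i\<in>Iineq. - (a i * V i \<eta>0)) = 0"
        using sum_nonpos[of Iineq "\<lambda>i. a i * V i \<eta>0"] le by (simp add: sum_negf)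
      then have "- (a i * V i \<eta>0) = 0"
        using le i finite_ineq sum_nonneg_eq_0_iff[of Iineq "\<lambda>i. - (a i * V i \<eta>0)"] by simp
      then show ?thesis using \<eta>0(2)[OF i] by simp
    qed
    have "\<exists>j\<in>Ieq. a j \<noteq> 0"
    proof (rule ccontr)
      assume "\<not> (\<exists>j\<in>Ieq. a j \<noteq> 0)"
      with a0 a1 show False unfolding split by simp
    qed
    moreover have "0 \<le> (\<Sum>i\<in>Ieq. a i * V i \<zeta>)" if \<zeta>: "\<zeta> \<in> Xi X0" for \<zeta>
    proof -
      \<comment> \<open>\<zeta> may have infinite objective or inequality values; a small step from
        \<open>\<eta>0\<close> towards it stays in \<open>Fin X0\<close>. As
        \<open>V i \<eta>0 = 0\<close>, affinity scales the equality values just by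
        \<alpha>.\<close>
      obtain \<alpha> where \<alpha>: "mix \<eta>0 \<zeta> \<alpha> \<in> Fin X0" "0 < \<alpha>" "\<alpha> < 1"
        using eventually_happens'[OF _ eventually_conj[OF mix_in_Xi_fin[OF \<eta>0(1) \<zeta> X0(1)] eventually_at_right_0_unit]]
        by auto
      have U: "\<eta>0 \<in> Xi UNIV" "\<zeta> \<in> Xi UNIV" using \<eta>0(1) \<zeta> Xi_subset_UNIV by (auto simp: Xi_fin_iff)
      have "V i (mix \<eta>0 \<zeta> \<alpha>) = \<alpha> * V i \<zeta>" if "i \<in> Ieq" for i
        using affine_on_Xi_real[OF aff[OF that] rv[OF that] U, of \<alpha>] \<alpha> \<eta>0(3)[OF that] by simp
      then have "(\<Sum>i\<in>I. a i * V i (mix \<eta>0 \<zeta> \<alpha>)) = \<alpha> * (\<Sum>i\<in>Ieq. a i * V i \<zeta>)"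
        unfolding split using a0 by (simp add: sum_distrib_left mult_ac)
      with nonneg[OF \<alpha>(1)] \<alpha>(2) show ?thesis by (simp add: zero_le_mult_iff)
    qed
    ultimately show False using not_one_sided unfolding one_sided_def by auto
  qed
  then obtain B where "\<And>k. t k \<le> B" by blast
  with lt that show thesis by (meson order_trans)
qed

section \<open>Exclusion of infinite runs\<close>

text \<open>What matters about the algorithm is that \<open>x j\<close> lies in every later
  \<open>S k\<close> and is a violation by a uniform margin \<open>c\<close>. The value of
  \<open>pL\<close> at \<open>x (r n)\<close> is compared for the iterations \<open>r n\<close> and
  \<open>r (Suc n)\<close>.\<close>

lemma no_infinite_run:
  fixes x :: "nat \<Rightarrow> 'a"
  assumes comp: "compact (UNIV :: 'a set)"
    and lsc: "\<And>i. i \<in> insert 0 Iineq \<Longrightarrow> lower_semicontinuous (\<Psi> i)"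
    and aff: "\<And>i. i \<in> Ieq \<Longrightarrow> affine_on_Xi (\<Psi> i)" and rv: "\<And>i. i \<in> Ieq \<Longrightarrow> real_valued_on_Xi (\<Psi> i)"
    and cont: "\<And>i. i \<in> Ieq \<Longrightarrow> continuous_map weak_topology euclideanreal (\<lambda>\<xi>. V i \<xi>)"
    and psi_eq: "\<And>i \<xi> x. i \<in> Ieq \<Longrightarrow> \<xi> \<in> Xi UNIV \<Longrightarrow> \<psi> i \<xi> x = V i (return borel x) - V i \<xi>"
    and cont0: "continuous_sensitivity (\<Psi> 0) (\<psi> 0)"
    and cont_ineq: "\<And>i. i \<in> Iineq \<Longrightarrow>
      continuous_sensitivity (\<Psi> i) (\<psi> i) \<or> integral_type_sensitivity (\<Psi> i) (\<psi> i)"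
    and \<eta>0: "\<eta>0 \<in> Fin X0" "\<And>i. i \<in> Iineq \<Longrightarrow> V i \<eta>0 < 0" "\<And>i. i \<in> Ieq \<Longrightarrow> V i \<eta>0 = 0"
    and not_one_sided: "\<not> one_sided Ieq ((\<lambda>\<xi> i. V i \<xi>) ` Xi X0)"
    and X0: "X0 \<in> sets borel" "\<And>k. X0 \<subseteq> S k"
    and S: "\<And>k. S k \<in> sets borel" "\<And>j k. j < k \<Longrightarrow> x j \<in> S k"
    and sp: "\<And>k. saddle (S k) (\<xi> k) (l k)"
    and c: "c > 0" "eventually (\<lambda>k. pL (\<xi> k) (l k) (x k) \<le> - c) sequentially"
  shows False
proof -
  have \<xi>F: "\<xi> k \<in> Fin (S k)" for k by (rule saddle_pointD(1)[OF sp])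
  then have \<xi>U: "\<xi> k \<in> Xi UNIV" for k using Xi_subset_UNIV by (auto simp: Xi_fin_iff)
  \<comment> \<open>For the objective this bound feeds the multiplier bound. For inequalities it
    joins \<open>V i (\<xi> k) \<le> 0\<close> to make the values bounded.\<close>
  have below: "\<exists>b. \<forall>k. b \<le> V i (\<xi> k)" if i: "i \<in> insert 0 Iineq" for i
  proof -
    have i': "i \<in> insert 0 I" using i by auto
    obtain b where b: "\<And>\<xi>. \<xi> \<in> Xi UNIV \<Longrightarrow> ereal b \<le> \<Psi> i \<xi>"
      by (rule lower_semicontinuous_bounded_below[OF comp lsc[OF i] proper[OF i']]) blast
    have "b \<le> V i (\<xi> k)" for k
      using b[OF \<xi>U[of k]] Psi_eq_V[OF \<xi>F[of k] i'] by (metis ereal_less_eq(3))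
    then show ?thesis by blast
  qed
  then obtain b where b: "\<And>i k. i \<in> insert 0 Iineq \<Longrightarrow> b i \<le> V i (\<xi> k)" by metis
  obtain B where B: "\<And>i k. i \<in> I \<Longrightarrow> \<bar>l k i\<bar> \<le> B"
    by (rule bounded_multipliers[where S = S and \<xi> = \<xi> and l = l, OF aff rv \<eta>0 not_one_sided X0 sp b[of 0]]) auto
  define G where "G = {i \<in> Iineq. integral_type_sensitivity (\<Psi> i) (\<psi> i)}"
  have "\<forall>i\<in>G. \<exists>g. bounded (range g) \<and> (\<forall>\<xi>\<in>dom (\<Psi> i). \<forall>x. \<psi> i \<xi> x = g x - V i \<xi>)"
    unfolding G_def integral_type_sensitivity_def by blast
  then obtain g where g: "\<And>i. i \<in> G \<Longrightarrow> bounded (range (g i))"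
      "\<And>i \<xi> x. i \<in> G \<Longrightarrow> \<xi> \<in> dom (\<Psi> i) \<Longrightarrow> \<psi> i \<xi> x = g i x - V i \<xi>" by metis
  \<comment> \<open>\<open>g i\<close> need not be continuous, so convergence of \<open>g i (x k)\<close> has to be enforced by the choice of the subsequence\<close>
  define f where "f i k = (l k i, if i \<in> Iineq then V i (\<xi> k) else 0, if i \<in> G then g i (x k) else 0)" for i k

  \<comment> \<open>Three successive extractions make the measures, then the points, then the
    finitely many real sequences in \<open>f\<close> converge.\<close>
  obtain r1 \<xi>' where r1: "strict_mono (r1 :: nat \<Rightarrow> nat)" "limitin weak_topology (\<xi> \<circ> r1) \<xi>' sequentially"
    by (rule sequentially_compact_Xi[of \<xi>, OF comp \<xi>U])
  obtain x' r2 where r2: "strict_mono (r2 :: nat \<Rightarrow> nat)" "((x \<circ> r1) \<circ> r2) \<longlonglongrightarrow> x'"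
    by (rule seq_compactE[OF compact_imp_seq_compact[OF comp], of "x \<circ> r1"]) auto
  have f_bd: "bounded (range (\<lambda>n. f i (r1 (r2 n))))" if i: "i \<in> I" for i
  proof -
    let ?g = "if i \<in> G then g i else (\<lambda>_. 0)"
    \<comment> \<open>The upper end 0 comes from feasibility; taking \<open>min (b i) 0\<close> as
      lower end keeps the default value 0 inside when \<open>i\<close> is no inequality
      index.\<close>
    have "(if i \<in> Iineq then V i (\<xi> k) else 0) \<in> {min (b i) 0..0}" for k
    proof (cases "i \<in> Iineq")
      case True
      then have "b i \<le> V i (\<xi> k)" by (intro b) simp
      with True saddle_point_V(1)[OF sp[of k] True] show ?thesis by (simp del: real_of_ereal_le_0)
    qed simp
    moreover have "l k i \<in> {-B..B}" for k using B[OF i, of k] by auto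
    moreover have "(if i \<in> G then g i (x k) else 0) \<in> range ?g" for k by auto
    ultimately have "range (\<lambda>n. f i (r1 (r2 n))) \<subseteq> {-B..B} \<times> ({min (b i) 0..0} \<times> range ?g)"
      unfolding f_def by blast
    moreover have "bounded ({-B..B} \<times> ({min (b i) 0..0} \<times> range ?g))"
      using g(1)[of i] by (intro bounded_Times) auto
    ultimately show ?thesis using bounded_subset by blast
  qed
  obtain r3 where r3: "strict_mono (r3 :: nat \<Rightarrow> nat)" "\<And>i. i \<in> I \<Longrightarrow> convergent (\<lambda>n. f i (r1 (r2 (r3 n))))"
    by (rule common_convergent_subsequence[of I "\<lambda>i n. f i (r1 (r2 n))", OF finite_I f_bd]) blast+
  define r where "r n = r1 (r2 (r3 n))" for n
  have r: "strict_mono r"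
    using strict_mono_o[OF r1(1) strict_mono_o[OF r2(1) r3(1)]] by (simp add: r_def[abs_def] comp_def)
  have \<xi>_lim: "limitin weak_topology (\<lambda>n. \<xi> (r n)) \<xi>' sequentially"
    using limitin_subsequence[OF strict_mono_o[OF r2(1) r3(1)] r1(2)] by (simp add: r_def comp_def)
  have x_lim: "(\<lambda>n. x (r n)) \<longlonglongrightarrow> x'"
    using LIMSEQ_subseq_LIMSEQ[OF r2(2) r3(1)] by (simp add: r_def comp_def)
  have "\<forall>i\<in>I. \<exists>a. (\<lambda>n. f i (r n)) \<longlonglongrightarrow> a" using r3(2) by (auto simp: convergent_def r_def)
  then obtain a where a: "\<And>i. i \<in> I \<Longrightarrow> (\<lambda>n. f i (r n)) \<longlonglongrightarrow> a i" by metis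
  have l_lim: "(\<lambda>n. l (r n) i) \<longlonglongrightarrow> fst (a i)" if "i \<in> I" for i
    using tendsto_fst[OF a[OF that]] by (simp add: f_def)
  have V_lim: "(\<lambda>n. V i (\<xi> (r n))) \<longlonglongrightarrow> fst (snd (a i))" if "i \<in> Iineq" for i
    using tendsto_fst[OF tendsto_snd[OF a[of i]]] that by (simp add: f_def)
  have g_lim: "(\<lambda>n. g i (x (r n))) \<longlonglongrightarrow> snd (snd (a i))" if "i \<in> G" for i
    using tendsto_snd[OF tendsto_snd[OF a[of i]]] that by (simp add: f_def G_def)

  have \<xi>'U: "\<xi>' \<in> Xi UNIV" using limitin_topspace[OF \<xi>_lim] by simp
  \<comment> \<open>Continuity of the sensitivity functions is available on the domains only. Lower
    semicontinuity keeps the limit there: inequality values stay at most 0, and objective values at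
    most that of the Slater point, a competitor in every iteration.\<close>
  have dom': "\<xi>' \<in> dom (\<Psi> i)" if i: "i \<in> insert 0 I" for i
  proof -
    consider "i \<in> Ieq" | "i \<in> Iineq" | "i = 0" using i by auto
    then show ?thesis
    proof cases
      case 1
      then show ?thesis using dom_real_valued_on_Xi[OF rv] \<xi>'U by auto
    next
      case 2
      have "\<Psi> i (\<xi> k) \<le> 0" for k using saddle_point_feasible[OF sp[of k]] 2 by (simp add: Xi_feas_def)
      then have "\<Psi> i \<xi>' \<le> 0"
        using lsc[of i] 2 by (intro lower_semicontinuous_limit_le[OF _ \<xi>_lim]) auto
      then show ?thesis using \<xi>'U by (auto simp: dom_def intro: le_less_trans[of _ 0])
    next
      case 3
      have "\<Psi> 0 (\<xi> k) \<le> ereal (V 0 \<eta>0)" for k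
      proof -
        have \<eta>F: "\<eta>0 \<in> Fin (S k)" using \<eta>0(1) Xi_fin_mono[OF X0(2,1)] by auto
        have "l k i * V i \<eta>0 \<le> 0" if "i \<in> I" for i
        proof (cases "i \<in> Ieq")
          case False
          then have "i \<in> Iineq" using that by auto
          then have "0 \<le> l k i" "V i \<eta>0 \<le> 0"
            using saddle_pointD(2)[OF sp[of k]] less_imp_le[OF \<eta>0(2)] unfolding multipliers_def by blast+
          then show ?thesis by (rule mult_nonneg_nonpos)
        qed (simp add: \<eta>0(3))
        then have "L \<eta>0 (l k) \<le> V 0 \<eta>0" unfolding Lagrangian_def by (auto intro!: sum_nonpos)
        then have "V 0 (\<xi> k) \<le> V 0 \<eta>0"
          using saddle_pointD(3)[OF sp \<eta>F] saddle_point_Lagrangian[OF sp[of k]] by simp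
        then show ?thesis using Psi_eq_V[OF \<xi>F[of k], of 0] by (metis ereal_less_eq(3) insertI1)
      qed
      then have "\<Psi> 0 \<xi>' \<le> ereal (V 0 \<eta>0)"
        using lsc[of 0] by (intro lower_semicontinuous_limit_le[OF _ \<xi>_lim]) auto
      then show ?thesis using \<xi>'U 3 by (auto simp: dom_def intro: le_less_trans)
    qed
  qed

  have \<xi>p_lim: "limitin weak_topology (\<lambda>n. \<xi> (r (p n))) \<xi>' sequentially" if "strict_mono p" for p :: "nat \<Rightarrow> nat"
    using limitin_subsequence[OF that \<xi>_lim] by (simp add: comp_def)
  \<comment> \<open>The index of the measure is shifted by \<open>p\<close> while the point stays
    \<open>x (r n)\<close>. One limit for all \<open>p\<close> makes the choices \<open>id\<close>
    and \<open>Suc\<close> comparable.\<close>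
  have "\<exists>u. \<forall>p::nat \<Rightarrow> nat. strict_mono p \<longrightarrow> (\<lambda>n. \<psi> i (\<xi> (r (p n))) (x (r n))) \<longlonglongrightarrow> u" if i: "i \<in> insert 0 I" for i
  proof -
    have \<xi>d: "\<xi> k \<in> dom (\<Psi> i)" for k using \<xi>F[of k] i by (auto simp: Xi_fin_iff)
    consider "i \<in> Ieq" | "continuous_sensitivity (\<Psi> i) (\<psi> i)" | "i \<in> G"
      using i cont0 cont_ineq[of i] by (auto simp: G_def)
    then show ?thesis
    proof cases
      case 1
      have "(\<lambda>n. V i (return borel (x (r n))) - V i (\<xi> (r (p n)))) \<longlonglongrightarrow> V i (return borel x') - V i \<xi>'"
        if "strict_mono p" for p :: "nat \<Rightarrow> nat"
        using continuous_map_limit[OF cont[OF 1] limitin_return[OF x_lim]]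
          continuous_map_limit[OF cont[OF 1] \<xi>p_lim[OF that]]
        by (intro tendsto_diff) (simp_all add: comp_def)
      then show ?thesis using psi_eq[OF 1 \<xi>U] by auto
    next
      case 2
      have "(\<lambda>n. \<psi> i (\<xi> (r (p n))) (x (r n))) \<longlonglongrightarrow> \<psi> i \<xi>' x'" if p: "strict_mono p" for p :: "nat \<Rightarrow> nat"
      proof -
        have "limitin (prod_topology (subtopology weak_topology (dom (\<Psi> i))) euclidean)
          (\<lambda>n. (\<xi> (r (p n)), x (r n))) (\<xi>', x') sequentially"
          unfolding limitin_pairwise using \<xi>p_lim[OF p] x_lim dom'[OF i] \<xi>d
          by (auto simp: limitin_subtopology comp_def)
        from continuous_map_limit[OF 2[unfolded continuous_sensitivity_def] this] show ?thesis
          by (simp add: comp_def)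
      qed
      then show ?thesis by blast
    next
      case 3
      \<comment> \<open>The limit of \<open>V i (\<xi> (r n))\<close> may differ from
        \<open>V i \<xi>'\<close>; it suffices that it exists and is the same after reindexing by
        \<open>p\<close>.\<close>
      have "(\<lambda>n. g i (x (r n)) - V i (\<xi> (r (p n)))) \<longlonglongrightarrow> snd (snd (a i)) - fst (snd (a i))"
        if "strict_mono p" for p :: "nat \<Rightarrow> nat"
        using g_lim[OF 3] LIMSEQ_subseq_LIMSEQ[OF V_lim that, of i] 3
        by (intro tendsto_diff) (simp_all add: comp_def G_def)
      then show ?thesis using g(2)[OF 3 \<xi>d] by auto
    qed
  qed
  then obtain u where u: "\<And>i p. i \<in> insert 0 I \<Longrightarrow> strict_mono (p :: nat \<Rightarrow> nat) \<Longrightarrow>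
    (\<lambda>n. \<psi> i (\<xi> (r (p n))) (x (r n))) \<longlonglongrightarrow> u i" by metis
  have pL_lim: "(\<lambda>n. pL (\<xi> (r (p n))) (l (r (p n))) (x (r n))) \<longlonglongrightarrow> u 0 + (\<Sum>i\<in>I. fst (a i) * u i)"
    if p: "strict_mono p" for p :: "nat \<Rightarrow> nat"
    unfolding psiL_def
  proof (intro tendsto_add tendsto_sum tendsto_mult)
    show "(\<lambda>n. l (r (p n)) i) \<longlonglongrightarrow> fst (a i)" if "i \<in> I" for i
      using LIMSEQ_subseq_LIMSEQ[OF l_lim[OF that] p] by (simp add: comp_def)
  qed (use u[OF _ p] in auto)
  have "u 0 + (\<Sum>i\<in>I. fst (a i) * u i) \<le> - c"
  proof (rule tendsto_upperbound[OF pL_lim[OF strict_mono_id]])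
    show "eventually (\<lambda>n. pL (\<xi> (r (id n))) (l (r (id n))) (x (r n)) \<le> - c) sequentially"
      using eventually_subseq[OF r c(2)] by simp
  qed simp
  \<comment> \<open>Since \<open>r n < r (Suc n)\<close>, the point \<open>x (r n)\<close> belongs
    to the discretization at \<open>r (Suc n)\<close>, where the saddle point makes
    \<open>pL\<close> nonnegative.\<close>
  moreover have "0 \<le> u 0 + (\<Sum>i\<in>I. fst (a i) * u i)"
  proof (rule tendsto_lowerbound[OF pL_lim[of Suc]])
    show "eventually (\<lambda>n. 0 \<le> pL (\<xi> (r (Suc n))) (l (r (Suc n))) (x (r n))) sequentially"
      using saddle_point_psiL_nonneg[OF sp S(1) S(2)] strict_monoD[OF r, of _ "Suc _"] by (intro always_eventually) auto
  qed (auto simp: strict_mono_Suc_iff)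
  ultimately show False using c(1) by linarith
qed

end

theorem theorem4p6:
  fixes \<Psi> :: "'i::zero \<Rightarrow> 'a::metric_space measure \<Rightarrow> ereal"
    and \<psi> :: "'i \<Rightarrow> 'a measure \<Rightarrow> 'a \<Rightarrow> real"
    and Iineq Ieq :: "'i set"
    and X0 :: "'a set"
    and \<delta> :: "nat \<Rightarrow> real" and \<epsilon> :: real
    and Xs :: "nat \<Rightarrow> 'a set" and \<xi> :: "nat \<Rightarrow> 'a measure"
    and mu :: "nat \<Rightarrow> 'i \<Rightarrow> real" and x :: "nat \<Rightarrow> 'a" and K :: enat
  assumes compact_X: "compact (UNIV :: 'a set)"
    and index_sets: "finite Iineq" "finite Ieq" "Iineq \<inter> Ieq = {}" "0 \<notin> Iineq \<union> Ieq"
    and Psi_lsc: "\<And>i. i \<in> insert 0 Iineq \<Longrightarrow> proper_on_Xi (\<Psi> i) \<and> lower_semicontinuous (\<Psi> i)"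
    and Psi_eq_cont: "\<And>i. i \<in> Ieq \<Longrightarrow>
      real_valued_on_Xi (\<Psi> i) \<and>
      continuous_map weak_topology euclideanreal (\<lambda>\<xi>. real_of_ereal (\<Psi> i \<xi>))"
    and objective: "convex_on_Xi (\<Psi> 0)" "sensitivity_function (\<Psi> 0) (\<psi> 0)"
      "continuous_sensitivity (\<Psi> 0) (\<psi> 0)"
    and inequality_constraints: "\<And>i. i \<in> Iineq \<Longrightarrow>
      convex_on_Xi (\<Psi> i) \<and> sensitivity_function (\<Psi> i) (\<psi> i) \<and>
      (continuous_sensitivity (\<Psi> i) (\<psi> i) \<or> integral_type_sensitivity (\<Psi> i) (\<psi> i))"
    and equality_constraints: "\<And>i. i \<in> Ieq \<Longrightarrow> affine_on_Xi (\<Psi> i)"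
    and psi_eq: "\<And>i \<xi> x. i \<in> Ieq \<Longrightarrow> \<xi> \<in> Xi UNIV \<Longrightarrow>
      \<psi> i \<xi> x = real_of_ereal (\<Psi> i (return borel x)) - real_of_ereal (\<Psi> i \<xi>)"
    and tolerances: "\<epsilon> > 0" "\<And>k. \<delta> k > 0" "limsup (\<lambda>k. ereal (\<delta> k)) < ereal \<epsilon>"
    and X0: "finite X0" "X0 \<noteq> {}"
    and slater: "\<exists>\<eta> \<in> Xi_fin \<Psi> Iineq Ieq X0.
      (\<forall>i \<in> Iineq. \<Psi> i \<eta> < 0) \<and> (\<forall>i \<in> Ieq. \<Psi> i \<eta> = 0)"
    and not_one_sided: "\<not> one_sided Ieq ((\<lambda>\<xi> i. real_of_ereal (\<Psi> i \<xi>)) ` Xi X0)"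
    and run: "generated_by_algorithm \<Psi> \<psi> Iineq Ieq X0 \<delta> \<epsilon> Xs \<xi> mu x K"
  shows "\<exists>n. K = enat n \<and> eps_optimal \<Psi> Iineq Ieq \<epsilon> (\<xi> n)"
proof -
  have rv: "real_valued_on_Xi (\<Psi> i)" and cont: "continuous_map weak_topology euclideanreal (\<lambda>\<xi>. real_of_ereal (\<Psi> i \<xi>))"
    if "i \<in> Ieq" for i using Psi_eq_cont[OF that] by auto
  have sens_eq: "sensitivity_function (\<Psi> i) (\<psi> i)" if "i \<in> Ieq" for i
    using that by (intro affine_sensitivity_function[OF compact_X equality_constraints rv cont psi_eq])
  interpret convex_program \<Psi> \<psi> Iineq Ieq
    using index_sets Psi_lsc objective inequality_constraints sens_eq
      real_valued_imp_proper_on_Xi[OF rv] affine_imp_convex_on_Xi[OF equality_constraints]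
    by unfold_locales auto
  have sp: "saddle_point \<Psi> Iineq Ieq (Xs k) (\<xi> k) (mu k)" if "enat k \<le> K" for k
    using run that unfolding generated_by_algorithm_def by blast
  show ?thesis
  proof (cases K)
    case (enat n)
    have "terminate_step (psiL \<psi> Iineq Ieq (\<xi> n) (mu n)) \<epsilon> (\<delta> n) (x n)"
      using run enat unfolding generated_by_algorithm_def by simp
    then have le: "ereal (pL (\<xi> n) (mu n) (x n)) \<le> (INF y. ereal (pL (\<xi> n) (mu n) y)) + ereal (\<delta> n)"
      and ge: "- \<epsilon> \<le> pL (\<xi> n) (mu n) (x n) - \<delta> n"
      by (auto simp: terminate_step_def approx_minimizer_def)
    \<comment> \<open>Approximate minimality puts every value at or above
      \<open>pL (\<xi> n) (mu n) (x n) - \<delta> n\<close>, and the stopping test bounds this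
      number below.\<close>
    have "- \<epsilon> \<le> pL (\<xi> n) (mu n) y" for y
    proof -
      have "(INF y. ereal (pL (\<xi> n) (mu n) y)) \<le> ereal (pL (\<xi> n) (mu n) y)" by (rule INF_lower) simp
      then have "(INF y. ereal (pL (\<xi> n) (mu n) y)) + ereal (\<delta> n) \<le> ereal (pL (\<xi> n) (mu n) y) + ereal (\<delta> n)"
        by (rule add_right_mono)
      with le have "ereal (pL (\<xi> n) (mu n) (x n)) \<le> ereal (pL (\<xi> n) (mu n) y + \<delta> n)"
        by (metis order_trans plus_ereal.simps(1))
      then show ?thesis using ge by simp
    qed
    moreover have "(\<integral>x. \<psi> i (\<xi> n) x \<partial>\<eta>) = V i \<eta> - V i (\<xi> n)" if i: "i \<in> Ieq" and \<eta>: "\<eta> \<in> Xi UNIV" for i \<eta>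
    proof -
      interpret prob_space \<eta> by (rule XiD[OF \<eta>])
      have "\<xi> n \<in> Xi UNIV"
        using saddle_pointD(1)[OF sp[of n]] enat Xi_subset_UNIV by (auto simp: Xi_fin_iff)
      then show ?thesis
        using affine_integral_representation[OF compact_X equality_constraints[OF i] rv[OF i] cont[OF i] \<eta>]
        by (simp add: psi_eq[OF i] prob_space)
    qed
    ultimately have "eps_optimal \<Psi> Iineq Ieq \<epsilon> (\<xi> n)"
      using eps_optimal_if_psiL_ge[OF sp[of n]] enat by simp
    with enat show ?thesis by blast
  next
    case infinity
    have Xs0: "Xs 0 = X0" and step: "\<And>k. continue_step (pL (\<xi> k) (mu k)) \<epsilon> (\<delta> k) (x k)"
      and Xs_Suc: "\<And>k. Xs (Suc k) = insert (x k) (Xs k)"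
      using run infinity unfolding generated_by_algorithm_def by auto
    have mono: "Xs j \<subseteq> Xs k" if "j \<le> k" for j k
      using that by (rule lift_Suc_mono_le[rotated]) (auto simp: Xs_Suc)
    have fin: "finite (Xs k)" for k by (induction k) (auto simp: Xs0 Xs_Suc X0)
    have borel: "A \<in> sets borel" if "finite A" for A :: "'a set"
      using that by (intro borel_closed finite_imp_closed)
    obtain \<eta> where \<eta>: "\<eta> \<in> Fin X0" "\<forall>i \<in> Iineq. \<Psi> i \<eta> < 0" "\<forall>i \<in> Ieq. \<Psi> i \<eta> = 0"
      using slater by blast
    have \<eta>_neg: "V i \<eta> < 0" if "i \<in> Iineq" for i
      using \<eta>(2) that Psi_eq_V[OF \<eta>(1), of i] by (metis UnCI ereal_less(2) ereal_less_eq(3) insertCI not_le zero_ereal_def)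
    \<comment> \<open>A level strictly between the limit superior of the tolerances and \<epsilon>;
      \<open>\<epsilon> - d\<close> becomes the uniform margin.\<close>
    obtain d where d: "limsup (\<lambda>k. ereal (\<delta> k)) < ereal d" "d < \<epsilon>"
      using ereal_dense2[OF tolerances(3)] by auto
    have "eventually (\<lambda>k. \<delta> k < d) sequentially"
      using Limsup_lessD[OF d(1)] by simp
    \<comment> \<open>A point from the search has value below \<open>- \<epsilon>\<close>, and
      \<open>0 < \<delta> k < d\<close> makes \<open>d\<close> positive; otherwise the value is
      below \<open>\<delta> k - \<epsilon>\<close>, hence below
      \<open>d - \<epsilon>\<close>.\<close>
    then have "eventually (\<lambda>k. pL (\<xi> k) (mu k) (x k) \<le> - (\<epsilon> - d)) sequentially"
    proof eventually_elim
      case (elim k)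
      then show ?case using step[of k] tolerances(2)[of k]
        by (auto simp: continue_step_def violation_set_def)
    qed
    then have False
    proof (rule no_infinite_run[OF compact_X _ equality_constraints rv cont psi_eq objective(3) _ \<eta>(1) \<eta>_neg _ not_one_sided
          borel[OF X0(1)] _ borel[OF fin] _ sp, rotated -1])
      show "X0 \<subseteq> Xs k" for k using mono[of 0 k] Xs0 by simp
      \<comment> \<open>\<open>x j\<close> enters at index \<open>Suc j\<close>, hence the strict
        inequality.\<close>
      show "x j \<in> Xs k" if "j < k" for j k
        using mono[of "Suc j" k] that by (auto simp: Xs_Suc)
    qed (use Psi_lsc inequality_constraints \<eta>(3) d(2) infinity in auto)
    then show ?thesis ..
  qed
qed

end
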